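(* Let $X_\Omega\subset\mathbb{C}^n$ be a star-shaped toric domain with moment region $\Omega\subset[0,\infty)^n$. Then the Ruelle density of $X_\Omega$ is given by \[\mathrm{ru}(X_\Omega)(z)=\sum_{i}\partial_i f_\Omega(\mu(z)).\] In particular, the Ruelle invariant of $X_\Omega$ is given by \[\mathrm{Ru}(X_\Omega)=\sum_{i}\int_\Omega\partial_i f_\Omega\cdot\mathrm{dvol}_{\mathbb{R}^n}.\]
   Context: On $\mathbb{C}^n$ with $z_j=x_j+iy_j$ let $\omega=\sum_j dx_j\wedge dy_j$ and $Z=\frac12\sum_j(x_j\partial_{x_j}+y_j\partial_{y_j})$. A star-shaped domain is a compact domain $X\subset\mathbb{C}^n$ with smooth boundary such that $0\in\mathrm{int}(X)$ and the radial vector field is transverse to $\partial X$. Toric domains. Let $\mu:\mathbb{C}^n\to[0,\infty)^n$, $\mu(z)=(\pi|z_1|^2,\dots,\pi|z_n|^2)$. The toric domain with moment region $\Omega\subset[0,\infty)^n$ is $X_\Omega=\mu^{-1}(\Omega)$. When $X_\Omega$ is star-shaped set $\partial_+\Omega=\mu(\partial X_\Omega)$; $f_\Omega:[0,\infty)^n\to[0,\infty)$ is the unique function, smooth away from $0$, with $f_\Omega^{-1}(1)=\partial_+\Omega$, $f_\Omega^{-1}[0,1]=\Omega$ and $\sum_i x_i\,\partial_i f_\Omega=f_\Omega$. Ruelle density and invariant of a star-shaped $X$. The canonical Hamiltonian $H_X:\mathbb{C}^n\setminus0\to(0,\infty)$ is the unique function with $ZH_X=H_X$ and $H_X^{-1}(1)=\partial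 X$. Let $\Phi_t$ be its Hamiltonian flow, i.e. the flow of $i\nabla H_X$. For $z\ne0$ view $d\Phi_t(z)\in\mathrm{Sp}(2n)$ via $T\mathbb{C}^n=\mathbb{C}^n$; let $d\Phi_t(z)=U_t(z)P_t(z)$ be its polar decomposition, $U_t(z)\in\mathrm{U}(n)$, $P_t(z)$ symmetric positive definite; let $t\mapsto\tilde u_t(z)$ be continuous with $\tilde u_0(z)=0$ and $\exp(2\pi i\tilde u_t(z))=\det_{\mathbb{C}}U_t(z)$. Then $\mathrm{ru}(X)=\lim_{T\to\infty}\tilde u_T/T$ (the limit exists almost everywhere and in $L^1$ on each $X_E=\{E\le H_X\le1\}$, $E>0$) and $\mathrm{Ru}(X)=\lim_{E\to0}\int_{X_E}\mathrm{ru}(X)\,\omega^n$.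
   Formalization: Since ω^n = n! times Lebesgue measure, the printed formula for Ru fails for n ≥ 2 if ω^n is read literally; the formal theorem proves it with ω^n/n! in the definition of Ru, and with an extra factor n! on the right for the literal ω^n. *)

theory Defs
  imports "HOL-Analysis.Analysis"
begin

primrec Ck_on :: "nat \<Rightarrow> 'a::real_normed_vector set \<Rightarrow> ('a \<Rightarrow> 'b::real_normed_vector) \<Rightarrow> bool" where
  "Ck_on 0 S f \<longleftrightarrow> continuous_on S f"
| "Ck_on (Suc k) S f \<longleftrightarrow> (\<forall>x\<in>S. f differentiable (at x)) \<and>
     (\<forall>v. Ck_on k S (\<lambda>x. frechet_derivative f (at x) v))"

(* Intended for open S only. *)
definition smooth_on :: "'a::real_normed_vector set \<Rightarrow> ('a \<Rightarrow> 'b::real_normed_vector) \<Rightarrow> bool" where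
  "smooth_on S f \<longleftrightarrow> (\<forall>k. Ck_on k S f)"

definition gradient :: "('a::real_inner \<Rightarrow> real) \<Rightarrow> 'a \<Rightarrow> 'a" where
  "gradient H z = (THE g. GDERIV H z :> g)"


(* C^n is complex^'n; its real inner product is the Euclidean one on R^(2n), and lborel on it is
   dx_1 dy_1 ... dx_n dy_n. *)

(* X is a domain with smooth boundary near p: it is a sublevel set of rho, and d rho is nonzero
   at p.  For p in the frontier this forces rho p = 0, and the tangent space of the boundary
   at p is the kernel of d rho. *)
definition boundary_defining ::
    "(complex^'n) set \<Rightarrow> complex^'n \<Rightarrow> (complex^'n \<Rightarrow> real) \<Rightarrow> bool" where
  "boundary_defining X p \<rho> \<longleftrightarrow>
     (\<exists>U. open U \<and> p \<in> U \<and> smooth_on U \<rho> \<and> X \<inter> U = {q \<in> U. \<rho> q \<le> 0}) \<and>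
     (\<exists>v. frechet_derivative \<rho> (at p) v \<noteq> 0)"

(* The last clause is transversality: the radial vector at p is p itself, and it is not in the
   kernel of d rho.  Connectedness is part of "domain"; without it, a ball together with
   a disjoint concentric shell would qualify. *)
definition star_shaped_domain :: "(complex^'n) set \<Rightarrow> bool" where
  "star_shaped_domain X \<longleftrightarrow> compact X \<and> connected X \<and> 0 \<in> interior X \<and>
     (\<forall>p \<in> frontier X. \<exists>\<rho>. boundary_defining X p \<rho> \<and> frechet_derivative \<rho> (at p) p \<noteq> 0)"

(* The value at 0 is a totalisation; it is needed for uniqueness. *)
definition canonical_hamiltonian :: "(complex^'n) set \<Rightarrow> complex^'n \<Rightarrow> real" where
  "canonical_hamiltonian X = (THE H.
     smooth_on (- {0}) H \<and> H 0 = 0 \<and>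
     (\<forall>z. z \<noteq> 0 \<longrightarrow> H z > 0 \<and> frechet_derivative H (at z) ((1/2) *\<^sub>R z) = H z) \<and>
     {z. z \<noteq> 0 \<and> H z = 1} = frontier X)"

definition hamiltonian_flow ::
    "(complex^'n \<Rightarrow> real) \<Rightarrow> real \<Rightarrow> complex^'n \<Rightarrow> complex^'n" where
  "hamiltonian_flow H t z = (THE w. \<exists>\<gamma>. \<gamma> 0 = z \<and>
     (\<forall>s. \<gamma> s \<noteq> 0 \<and> (\<gamma> has_vector_derivative \<i> *s gradient H (\<gamma> s)) (at s)) \<and> \<gamma> t = w)"

definition unitary_matrix :: "complex^'n^'n \<Rightarrow> bool" where
  "unitary_matrix U \<longleftrightarrow> (\<chi> i j. cnj (U $ j $ i)) ** U = mat 1"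

(* A is real linear on R^(2n); symmetry and positivity of P refer to the real inner product. *)
definition polar_decomposition ::
    "(complex^'n \<Rightarrow> complex^'n) \<Rightarrow> complex^'n^'n \<Rightarrow> (complex^'n \<Rightarrow> complex^'n) \<Rightarrow> bool" where
  "polar_decomposition A U P \<longleftrightarrow> unitary_matrix U \<and> linear P \<and>
     (\<forall>v w. P v \<bullet> w = v \<bullet> P w) \<and> (\<forall>v. v \<noteq> 0 \<longrightarrow> P v \<bullet> v > 0) \<and> (\<forall>v. A v = U *v P v)"

definition unitary_part :: "(complex^'n \<Rightarrow> complex^'n) \<Rightarrow> complex^'n^'n" where
  "unitary_part A = (THE U. \<exists>P. polar_decomposition A U P)"

definition rotation_lift :: "(complex^'n) set \<Rightarrow> complex^'n \<Rightarrow> real \<Rightarrow> real" where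
  "rotation_lift X z = (THE u. continuous_on UNIV u \<and> u 0 = 0 \<and>
     (\<forall>t. exp (2 * of_real pi * \<i> * of_real (u t)) =
        det (unitary_part
          (frechet_derivative (hamiltonian_flow (canonical_hamiltonian X) t) (at z)))))"

definition has_ruelle_density :: "(complex^'n) set \<Rightarrow> complex^'n \<Rightarrow> real \<Rightarrow> bool" where
  "has_ruelle_density X z r \<longleftrightarrow> ((\<lambda>T. rotation_lift X z T / T) \<longlongrightarrow> r) at_top"

definition ruelle_density :: "(complex^'n) set \<Rightarrow> complex^'n \<Rightarrow> real" where
  "ruelle_density X z = (THE r. has_ruelle_density X z r)"

definition hamiltonian_shell :: "(complex^'n) set \<Rightarrow> real \<Rightarrow> (complex^'n) set" where
  "hamiltonian_shell X E =
     {z. z \<noteq> 0 \<and> E \<le> canonical_hamiltonian X z \<and> canonical_hamiltonian X z \<le> 1}"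

(* The measure of the volume form omega^n = n! dx_1 dy_1 ... dx_n dy_n. *)
definition omega_power_measure :: "(complex^'n) measure" where
  "omega_power_measure = density lborel (\<lambda>_. of_nat (fact CARD('n)))"

(* The normalisation M of the volume is a parameter: omega_power_measure is omega^n, and lborel is
   omega^n / n!. *)
definition has_ruelle_invariant ::
    "(complex^'n) measure \<Rightarrow> (complex^'n) set \<Rightarrow> real \<Rightarrow> bool" where
  "has_ruelle_invariant M X R \<longleftrightarrow>
     (\<forall>E>0. set_integrable M (hamiltonian_shell X E) (ruelle_density X)) \<and>
     ((\<lambda>E. LINT z:hamiltonian_shell X E|M. ruelle_density X z) \<longlongrightarrow> R) (at_right 0)"

definition ruelle_invariant :: "(complex^'n) measure \<Rightarrow> (complex^'n) set \<Rightarrow> real" where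
  "ruelle_invariant M X = (THE R. has_ruelle_invariant M X R)"


definition orthant :: "(real^'n) set" where
  "orthant = {x. \<forall>i. 0 \<le> x $ i}"

definition moment_map :: "complex^'n \<Rightarrow> real^'n" where
  "moment_map z = (\<chi> i. pi * (cmod (z $ i))\<^sup>2)"

definition toric_domain :: "(real^'n) set \<Rightarrow> (complex^'n) set" where
  "toric_domain \<Omega> = moment_map -` \<Omega>"

(* For functions on the orthant: one-sided where x $ i = 0. *)
definition partial_deriv :: "'n::finite \<Rightarrow> (real^'n \<Rightarrow> real) \<Rightarrow> real^'n \<Rightarrow> real" where
  "partial_deriv i f x =
     vector_derivative (\<lambda>t. f (x + t *\<^sub>R axis i 1)) (at 0 within {t. 0 \<le> x $ i + t})"

(* f is the function f_Omega.  Only its values on the orthant matter.  Smoothness up to the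
   faces of the orthant means that f extends smoothly to a neighbourhood. *)
definition toric_gauge :: "(real^'n) set \<Rightarrow> (real^'n \<Rightarrow> real) \<Rightarrow> bool" where
  "toric_gauge \<Omega> f \<longleftrightarrow>
     (\<exists>U g. open U \<and> orthant - {0} \<subseteq> U \<and> smooth_on U g \<and> (\<forall>x \<in> orthant - {0}. g x = f x)) \<and>
     (\<forall>x \<in> orthant. 0 \<le> f x) \<and>
     {x \<in> orthant. f x = 1} = moment_map ` frontier (toric_domain \<Omega>) \<and>
     {x \<in> orthant. 0 \<le> f x \<and> f x \<le> 1} = \<Omega> \<and>
     (\<forall>x \<in> orthant. (\<Sum>i\<in>UNIV. x $ i * partial_deriv i f x) = f x)"

end

theory Submission
  imports Defs
begin

text \<open>
  The canonical Hamiltonian of a toric domain is \<open>H = f \<circ> \<mu>\<close>, and its flow rotates the \<open>i\<close>-th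
  coordinate with constant angular speed \<open>2\<pi> \<partial>\<^sub>i f(\<mu>(z))\<close>. Hence the linearised flow at time \<open>t\<close> is a diagonal
  rotation, whose determinant winds at rate \<open>\<Sum>\<^sub>i \<partial>\<^sub>i f(\<mu>(z))\<close>, composed with \<open>1 + t N\<close> where \<open>N\<close> comes from the
  Hessian of \<open>f\<close>. In a suitable unitary basis \<open>1 + t N\<close> is a product of planar shears
  \<open>c \<mapsto> c + \<i> t \<lambda> Re c\<close>, whose unitary parts are the rotations by \<open>arctan (t \<lambda> / 2)\<close>. These angles stay bounded
  and do not contribute to the limit. The formula for the Ruelle invariant follows because
  \<open>\<mu>\<close> pushes Lebesgue measure forward to Lebesgue measure on the orthant.
\<close>

section \<open>Functions of class C^k\<close>

text \<open>The Hamiltonian, its flow, the unitary part and the lift are \<open>THE\<close> terms,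
  so each needs existence and uniqueness: homogeneity along rays for the Hamiltonian, conserved
  moduli for the flow, uniqueness of positive square roots for the unitary part, integrality of
  differences for the lift. The eigenbasis of the Hessian term at \<open>z\<close> can be chosen
  independently of \<open>t\<close>; this gives the determinant in closed form for all times at
  once, hence an explicit continuous lift. Two obstacles come from \<open>f\<close>. It is
  controlled only on the orthant, so derivatives are computed from a smooth extension
  \<open>g\<close> and must be shown to depend on \<open>f\<close> alone, also on the faces. It is
  not assumed smooth at 0, but its partial derivatives are homogeneous of degree 0, hence bounded,
  which supplies the dominating function for the limit \<open>E\<close> to 0. The formula without a
  factor holds for Lebesgue measure; the measure of \<open>omega^n\<close> is \<open>n!\<close>
  times as large, which is why both normalisations appear.\<close>

lemma frechet_derivative_eqI:
  "(f has_derivative f') (at x) \<Longrightarrow> frechet_derivative f (at x) = f'"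
  by (metis frechet_derivative_at)

lemma frechet_derivative_cong_open:
  assumes "open S" "x \<in> S" "\<And>y. y \<in> S \<Longrightarrow> f y = g y"
  shows "frechet_derivative f (at x) = frechet_derivative g (at x)"
proof -
  have "(f has_derivative D) (at x) \<longleftrightarrow> (g has_derivative D) (at x)" for D
    using has_derivative_transform_within_open[OF _ assms(1,2), of f D UNIV g]
      has_derivative_transform_within_open[OF _ assms(1,2), of g D UNIV f] assms(3) by auto
  then show ?thesis by (simp add: frechet_derivative_def)
qed

lemma differentiable_cong_open:
  assumes "open S" "x \<in> S" "\<And>y. y \<in> S \<Longrightarrow> f y = g y"
  shows "f differentiable (at x) \<longleftrightarrow> g differentiable (at x)"
proof -
  have "(f has_derivative D) (at x) \<longleftrightarrow> (g has_derivative D) (at x)" for D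
    using has_derivative_transform_within_open[OF _ assms(1,2), of f D UNIV g]
      has_derivative_transform_within_open[OF _ assms(1,2), of g D UNIV f] assms(3) by auto
  then show ?thesis by (simp add: differentiable_def)
qed

text \<open>Functions such as \<open>H\<close> and \<open>g\<close> composed with
  \<open>moment_map\<close> are compared only on an open set. Openness makes their derivatives agree
  there too, so the induction passes from one order to the next.\<close>

lemma Ck_on_cong:
  assumes "open S" "\<And>x. x \<in> S \<Longrightarrow> f x = g x"
  shows "Ck_on k S f \<longleftrightarrow> Ck_on k S g"
  using assms
proof (induction k arbitrary: f g)
  case 0
  then show ?case using continuous_on_cong[OF refl, of S f g] by simp
next
  case (Suc k)
  have "Ck_on k S (\<lambda>x. frechet_derivative f (at x) v) \<longleftrightarrow>
      Ck_on k S (\<lambda>x. frechet_derivative g (at x) v)" for v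
  proof (rule Suc.IH[OF Suc.prems(1)])
    show "frechet_derivative f (at x) v = frechet_derivative g (at x) v" if "x \<in> S" for x
      by (simp add: frechet_derivative_cong_open[OF Suc.prems(1) that Suc.prems(2)])
  qed
  moreover have "f differentiable (at x) \<longleftrightarrow> g differentiable (at x)" if "x \<in> S" for x
    by (rule differentiable_cong_open[OF Suc.prems(1) that Suc.prems(2)])
  ultimately show ?case by simp
qed

lemma Ck_on_SucD: "Ck_on (Suc k) S f \<Longrightarrow> Ck_on k S f"
proof (induction k arbitrary: f)
  case 0
  then have "\<forall>x\<in>S. f differentiable (at x)" by simp
  then show ?case
    by (simp add: continuous_at_imp_continuous_on differentiable_imp_continuous_within)
next
  case (Suc k)
  have 1: "\<forall>x\<in>S. f differentiable (at x)"
    and 2: "\<forall>v. Ck_on (Suc k) S (\<lambda>x. frechet_derivative f (at x) v)"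
    using Suc.prems unfolding Ck_on.simps(2)[of "Suc k"] by blast+
  then show ?case by (subst Ck_on.simps(2)) (use 1 2 Suc.IH in blast)
qed

text \<open>Replaces the choice \<open>frechet_derivative\<close> by a derivative given as a
  formula; the closure rules below then reduce to the same rules at the lower order.\<close>

lemma Ck_on_SucI:
  assumes "open S" "\<And>x. x \<in> S \<Longrightarrow> (f has_derivative f' x) (at x)"
    and "\<And>v. Ck_on k S (\<lambda>x. f' x v)"
  shows "Ck_on (Suc k) S f"
proof -
  have "frechet_derivative f (at x) = f' x" if "x \<in> S" for x
    using assms(2) that by (simp add: frechet_derivative_eqI)
  then have "Ck_on k S (\<lambda>x. frechet_derivative f (at x) v) \<longleftrightarrow> Ck_on k S (\<lambda>x. f' x v)" for v
    by (intro Ck_on_cong assms(1)) simp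
  with assms show ?thesis by (auto simp: differentiable_def)
qed

lemma Ck_on_SucD_has_derivative:
  assumes "Ck_on (Suc k) S f" "x \<in> S"
  shows "(f has_derivative frechet_derivative f (at x)) (at x)"
  using assms by (simp add: frechet_derivative_works)

lemma Ck_on_const: "open S \<Longrightarrow> Ck_on k S (\<lambda>x. c)"
proof (induction k arbitrary: c)
  case (Suc k)
  show ?case
    by (rule Ck_on_SucI[where f' = "\<lambda>x v. 0"]) (use Suc in auto)
qed auto

lemma Ck_on_bounded_linear:
  assumes "open S" "bounded_linear f"
  shows "Ck_on k S f"
proof (cases k)
  case 0
  then show ?thesis using assms by (simp add: linear_continuous_on)
next
  case (Suc m)
  show ?thesis unfolding Suc
    by (rule Ck_on_SucI[where f' = "\<lambda>x. f"])
      (use assms in \<open>auto simp: bounded_linear_imp_has_derivative Ck_on_const\<close>)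
qed

lemma Ck_on_add:
  assumes "open S" "Ck_on k S f" "Ck_on k S g"
  shows "Ck_on k S (\<lambda>x. f x + g x)"
  using assms
proof (induction k arbitrary: f g)
  case 0
  then show ?case by (simp add: continuous_on_add)
next
  case (Suc k)
  show ?case
    by (rule Ck_on_SucI[OF Suc.prems(1) has_derivative_add])
       (use Suc in \<open>auto simp: frechet_derivative_works\<close>)
qed

lemma Ck_on_sum:
  assumes "open S" "\<And>i. i \<in> I \<Longrightarrow> Ck_on k S (f i)"
  shows "Ck_on k S (\<lambda>x. \<Sum>i\<in>I. f i x)"
  using assms(2)
  by (induction I rule: infinite_finite_induct) (auto simp: assms(1) Ck_on_const Ck_on_add)

text \<open>The product rule returns the undifferentiated factors as well; \<open>Ck_on_SucD\<close>
  lowers their order so that the induction hypothesis applies.\<close>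

lemma Ck_on_mult:
  fixes f g :: "'a::real_normed_vector \<Rightarrow> 'b::real_normed_algebra"
  assumes "open S" "Ck_on k S f" "Ck_on k S g"
  shows "Ck_on k S (\<lambda>x. f x * g x)"
  using assms
proof (induction k arbitrary: f g)
  case 0
  then show ?case by (simp add: continuous_on_mult)
next
  case (Suc k)
  show ?case
  proof (rule Ck_on_SucI[OF Suc.prems(1) has_derivative_mult])
    fix v
    show "Ck_on k S (\<lambda>x. f x * frechet_derivative g (at x) v + frechet_derivative f (at x) v * g x)"
      using Suc Ck_on_SucD[OF Suc.prems(2)] Ck_on_SucD[OF Suc.prems(3)]
      by (intro Ck_on_add Suc.IH) auto
  qed (use Suc in \<open>auto simp: frechet_derivative_works\<close>)
qed

section \<open>Coordinates and the chain rule for vector-valued maps\<close>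

lemma vec_eq_sum_axis: "(x::real^'n) = (\<Sum>i\<in>UNIV. (x $ i) *\<^sub>R axis i 1)"
  using basis_expansion[of x] by (simp add: scalar_mult_eq_scaleR)

lemma linear_eq_sum_axis:
  fixes L :: "real^'n \<Rightarrow> 'b::real_vector"
  assumes "linear L" shows "L v = (\<Sum>i\<in>UNIV. (v $ i) *\<^sub>R L (axis i 1))"
proof -
  have "L v = L (\<Sum>i\<in>UNIV. (v $ i) *\<^sub>R axis i 1)" using vec_eq_sum_axis[of v] by argo
  then show ?thesis by (simp only: linear_sum[OF assms] linear_scale[OF assms])
qed

lemma has_derivative_vecI:
  fixes f :: "'a::real_normed_vector \<Rightarrow> 'b::euclidean_space^'n"
  assumes "\<And>i. ((\<lambda>x. f x $ i) has_derivative (\<lambda>v. f' v $ i)) (at x within S)"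
  shows "(f has_derivative f') (at x within S)"
  unfolding has_derivative_componentwise_within[of f]
  using has_derivative_inner_left[OF assms] by (auto simp: Basis_vec_def inner_axis)

lemma has_derivative_vec_nth:
  fixes f :: "'a::real_normed_vector \<Rightarrow> 'b::euclidean_space^'n"
  assumes "(f has_derivative f') F"
  shows "((\<lambda>x. f x $ i) has_derivative (\<lambda>v. f' v $ i)) F"
  by (rule bounded_linear.has_derivative[OF bounded_linear_vec_nth assms])

text \<open>The derivative of the composite is a sum of products of component derivatives of
  \<open>m\<close> with partial derivatives of \<open>g\<close> taken at \<open>m x\<close>. Since
  \<open>m\<close> has all orders from the start, the induction runs over \<open>g\<close>
  alone.\<close>

lemma Ck_on_compose_vec:
  fixes m :: "'a::real_normed_vector \<Rightarrow> real^'n" and g :: "real^'n \<Rightarrow> real"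
  assumes "open S" "open U" "m ` S \<subseteq> U"
    and "\<And>i k. Ck_on k S (\<lambda>x. m x $ i)" "Ck_on k U g"
  shows "Ck_on k S (\<lambda>x. g (m x))"
  using assms(5)
proof (induction k arbitrary: g)
  case 0
  have "continuous_on S (\<lambda>x. m x $ i)" for i using assms(4)[of 0] by simp
  then have "continuous_on S (\<lambda>x. \<chi> i. m x $ i)"
    by (rule continuous_on_vec_lambda)
  then have "continuous_on S m" by simp
  then show ?case using 0 assms(3) by (auto intro: continuous_on_compose2)
next
  case (Suc k)
  define m' where "m' x = (\<lambda>v. \<chi> i. frechet_derivative (\<lambda>x. m x $ i) (at x) v)" for x
  have m: "(m has_derivative m' x) (at x)" if "x \<in> S" for x
    by (rule has_derivative_vecI)
      (use Ck_on_SucD_has_derivative[OF assms(4) that] in \<open>simp add: m'_def\<close>)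
  let ?g' = "\<lambda>x. frechet_derivative g (at x)"
  have g: "(g has_derivative ?g' x) (at x)" if "x \<in> U" for x
    using Ck_on_SucD_has_derivative[OF Suc.prems that] .
  show ?case
  proof (rule Ck_on_SucI[OF assms(1)])
    fix x assume x: "x \<in> S"
    have "(g \<circ> m has_derivative ?g' (m x) \<circ> m' x) (at x)"
      using x assms(3) by (intro diff_chain_at m g) auto
    moreover have "?g' (m x) \<circ> m' x = (\<lambda>v. \<Sum>i\<in>UNIV. m' x v $ i * ?g' (m x) (axis i 1))"
    proof
      fix v
      have "linear (?g' (m x))"
        using g[of "m x"] x assms(3) has_derivative_linear by blast
      from linear_eq_sum_axis[OF this, of "m' x v"]
      show "(?g' (m x) \<circ> m' x) v = (\<Sum>i\<in>UNIV. m' x v $ i * ?g' (m x) (axis i 1))" by simp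
    qed
    ultimately show "((\<lambda>x. g (m x)) has_derivative
        (\<lambda>v. \<Sum>i\<in>UNIV. m' x v $ i * ?g' (m x) (axis i 1))) (at x)"
      by (simp add: o_def)
  next
    fix v
    show "Ck_on k S (\<lambda>x. \<Sum>i\<in>UNIV. m' x v $ i * ?g' (m x) (axis i 1))"
    proof (intro Ck_on_sum Ck_on_mult assms(1))
      fix i
      show "Ck_on k S (\<lambda>x. m' x v $ i)"
        using assms(4)[of "Suc k" i] by (simp add: m'_def)
      show "Ck_on k S (\<lambda>x. ?g' (m x) (axis i 1))"
        using Suc.prems by (intro Suc.IH) simp
    qed
  qed
qed

text \<open>The second difference of \<open>g\<close> over a small parallelogram is symmetric in its
  two sides. Two applications of the mean value theorem express it by either mixed derivative at
  some point of the parallelogram, and continuity identifies the limits.\<close>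

lemma frechet_derivative_symmetric:
  fixes g :: "'a::real_normed_vector \<Rightarrow> real"
  assumes "open U" "x \<in> U" "Ck_on 2 U g"
  shows "frechet_derivative (\<lambda>y. frechet_derivative g (at y) v) (at x) w =
         frechet_derivative (\<lambda>y. frechet_derivative g (at y) w) (at x) v"
proof -
  define h where "h v w y = frechet_derivative (\<lambda>y. frechet_derivative g (at y) v) (at y) w" for v w y
  have C1: "Ck_on (Suc (Suc 0)) U g" using assms(3) by (simp add: numeral_2_eq_2)
  have d1: "(g has_derivative frechet_derivative g (at y)) (at y)" if "y \<in> U" for y
    using Ck_on_SucD_has_derivative[OF C1 that] .
  have d2: "((\<lambda>y. frechet_derivative g (at y) v) has_derivative (\<lambda>w. h v w y)) (at y)"
    if "y \<in> U" for y v
    using C1 that unfolding h_def by (auto simp: frechet_derivative_works[symmetric])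
  have d3: "continuous_on U (h v w)" for v w using C1 by (simp add: h_def[abs_def])
  have mvt: "\<exists>s t. 0 < s \<and> s < e \<and> 0 < t \<and> t < e \<and>
      g (x + e *\<^sub>R v + e *\<^sub>R w) - g (x + e *\<^sub>R v) - g (x + e *\<^sub>R w) + g x
        = e * e * h v w (x + s *\<^sub>R v + t *\<^sub>R w)"
    if e: "0 < e" and sub: "\<And>s t. 0 \<le> s \<Longrightarrow> s \<le> e \<Longrightarrow> 0 \<le> t \<Longrightarrow> t \<le> e \<Longrightarrow> x + s *\<^sub>R v + t *\<^sub>R w \<in> U"
    for e v w
  proof -
    \<comment> \<open>\<open>?F\<close> is the increment along \<open>e *\<^sub>R w\<close>; the
      mean value theorem in \<open>s\<close> and then in \<open>t\<close> turns the second
      difference into a mixed derivative.\<close>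
    let ?F = "\<lambda>s. g (x + s *\<^sub>R v + e *\<^sub>R w) - g (x + s *\<^sub>R v)"
    let ?F' = "\<lambda>s. frechet_derivative g (at (x + s *\<^sub>R v + e *\<^sub>R w)) v
        - frechet_derivative g (at (x + s *\<^sub>R v)) v"
    have F1: "((\<lambda>s. g (x + s *\<^sub>R v + t *\<^sub>R w)) has_real_derivative
        frechet_derivative g (at (x + s *\<^sub>R v + t *\<^sub>R w)) v) (at s)"
      if "0 \<le> s" "s \<le> e" "0 \<le> t" "t \<le> e" for s t
    proof -
      have "((\<lambda>s. x + s *\<^sub>R v + t *\<^sub>R w) has_derivative (\<lambda>s. s *\<^sub>R v)) (at s)"
        by (auto intro!: derivative_eq_intros)
      from has_derivative_compose[OF this d1[OF sub[OF that]]]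
      show ?thesis
        using has_derivative_linear[OF d1[OF sub[OF that]]]
        by (simp add: has_field_derivative_def linear_scale mult.commute[of _ "frechet_derivative _ _ _"] mult_commute_abs)
    qed
    have F: "(?F has_real_derivative ?F' s) (at s)" if "0 \<le> s" "s \<le> e" for s
      using F1[OF that, of e] F1[OF that, of 0] e by (auto intro!: derivative_intros)
    obtain s where s: "0 < s" "s < e" "?F e - ?F 0 = (e - 0) * ?F' s"
      using MVT2[of 0 e ?F ?F'] e F by auto
    let ?G = "\<lambda>t. frechet_derivative g (at (x + s *\<^sub>R v + t *\<^sub>R w)) v"
    have G: "(?G has_real_derivative h v w (x + s *\<^sub>R v + t *\<^sub>R w)) (at t)" if "0 \<le> t" "t \<le> e" for t
    proof -
      have inU: "x + s *\<^sub>R v + t *\<^sub>R w \<in> U" using that s sub by auto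
      have "((\<lambda>t. x + s *\<^sub>R v + t *\<^sub>R w) has_derivative (\<lambda>t. t *\<^sub>R w)) (at t)"
        by (auto intro!: derivative_eq_intros)
      from has_derivative_compose[OF this d2[OF inU]]
      have "(?G has_derivative (\<lambda>t'. h v (t' *\<^sub>R w) (x + s *\<^sub>R v + t *\<^sub>R w))) (at t)" .
      moreover have "h v (t' *\<^sub>R w) (x + s *\<^sub>R v + t *\<^sub>R w) = h v w (x + s *\<^sub>R v + t *\<^sub>R w) * t'" for t'
        using linear_scale[OF has_derivative_linear[OF d2[OF inU, of v]]] by simp
      ultimately show ?thesis by (simp add: has_field_derivative_def)
    qed
    obtain t where t: "0 < t" "t < e" "?G e - ?G 0 = (e - 0) * h v w (x + s *\<^sub>R v + t *\<^sub>R w)"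
      using MVT2[of 0 e ?G "\<lambda>t. h v w (x + s *\<^sub>R v + t *\<^sub>R w)"] e G by auto
    show ?thesis using s t by (intro exI[of _ s] exI[of _ t]) (simp add: algebra_simps)
  qed
  obtain r where r: "0 < r" "ball x r \<subseteq> U" using assms(1,2) openE by blast
  \<comment> \<open>\<open>e n * K = r / (2 * (n + 1))\<close> keeps the parallelograms with sides
    \<open>e n *\<^sub>R v\<close> and \<open>e n *\<^sub>R w\<close> inside
    \<open>ball x r\<close>; the summand 1 covers \<open>v = w = 0\<close>.\<close>
  define K where "K = norm v + norm w + 1"
  have K: "K > 0" by (simp add: K_def add_nonneg_pos)
  define e where "e n = r / (2 * K * real (Suc n))" for n
  have e0: "0 < e n" for n using r K by (simp add: e_def)
  have eK: "e n * K < r" for n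
  proof -
    have "e n * K = r / (2 * real (Suc n))" using K by (simp add: e_def)
    also have "\<dots> < r" using r(1) by (simp add: divide_less_eq)
    finally show ?thesis .
  qed
  have e_lim: "e \<longlonglongrightarrow> 0"
  proof -
    have "(\<lambda>n. r / (2 * K) * inverse (real (Suc n))) \<longlonglongrightarrow> r / (2 * K) * 0"
      by (intro tendsto_intros LIMSEQ_inverse_real_of_nat)
    then show ?thesis by (simp add: e_def[abs_def] divide_simps)
  qed
  have inball: "x + s *\<^sub>R v + t *\<^sub>R w \<in> U" if "0 \<le> s" "s \<le> e n" "0 \<le> t" "t \<le> e n" for s t n
  proof -
    have "norm (s *\<^sub>R v + t *\<^sub>R w) \<le> s * norm v + t * norm w"
      using norm_triangle_ineq[of "s *\<^sub>R v" "t *\<^sub>R w"] that by simp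
    also have "\<dots> \<le> e n * norm v + e n * norm w"
      using that by (intro add_mono mult_right_mono) auto
    also have "\<dots> \<le> e n * K" using e0[of n] by (simp add: K_def algebra_simps)
    finally have "norm (s *\<^sub>R v + t *\<^sub>R w) < r" using eK[of n] by simp
    moreover have "dist x (x + s *\<^sub>R v + t *\<^sub>R w) = norm (s *\<^sub>R v + t *\<^sub>R w)"
      by (subst dist_commute) (simp add: dist_norm add.assoc)
    ultimately show ?thesis using r(2) by auto
  qed
  have "\<exists>s t s' t'. 0 < s \<and> s < e n \<and> 0 < t \<and> t < e n \<and> 0 < s' \<and> s' < e n \<and> 0 < t' \<and> t' < e n \<and>
      h v w (x + s *\<^sub>R v + t *\<^sub>R w) = h w v (x + t' *\<^sub>R v + s' *\<^sub>R w)" for n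
  proof -
    obtain s t where st: "0 < s" "s < e n" "0 < t" "t < e n" 
      "g (x + e n *\<^sub>R v + e n *\<^sub>R w) - g (x + e n *\<^sub>R v) - g (x + e n *\<^sub>R w) + g x
        = e n * e n * h v w (x + s *\<^sub>R v + t *\<^sub>R w)"
      using mvt[OF e0, of n v w] inball by blast
    have "x + s *\<^sub>R w + t *\<^sub>R v \<in> U" if "0 \<le> s" "s \<le> e n" "0 \<le> t" "t \<le> e n" for s t
      using inball[of t n s] that by (simp add: algebra_simps)
    then obtain s' t' where st': "0 < s'" "s' < e n" "0 < t'" "t' < e n" 
      "g (x + e n *\<^sub>R w + e n *\<^sub>R v) - g (x + e n *\<^sub>R w) - g (x + e n *\<^sub>R v) + g x
        = e n * e n * h w v (x + s' *\<^sub>R w + t' *\<^sub>R v)"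
      using mvt[OF e0, of n w v] by blast
    \<comment> \<open>Exchanging \<open>v\<close> and \<open>w\<close> does not change the second
      difference, so dividing by \<open>e n * e n\<close> equates the two mixed derivatives at
      nearby points.\<close>
    have eq: "x + e n *\<^sub>R w + e n *\<^sub>R v = x + e n *\<^sub>R v + e n *\<^sub>R w"
      "x + s' *\<^sub>R w + t' *\<^sub>R v = x + t' *\<^sub>R v + s' *\<^sub>R w" by simp_all
    have "e n * e n * h v w (x + s *\<^sub>R v + t *\<^sub>R w) = e n * e n * h w v (x + t' *\<^sub>R v + s' *\<^sub>R w)"
      using st(5) st'(5) unfolding eq by linarith
    then have "h v w (x + s *\<^sub>R v + t *\<^sub>R w) = h w v (x + t' *\<^sub>R v + s' *\<^sub>R w)" using e0[of n] by simp
    then show ?thesis using st st' by blast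
  qed
  then obtain s t s' t' where q: "\<And>n. 0 < s n \<and> s n < e n \<and> 0 < t n \<and> t n < e n \<and>
      0 < s' n \<and> s' n < e n \<and> 0 < t' n \<and> t' n < e n"
    "\<And>n. h v w (x + s n *\<^sub>R v + t n *\<^sub>R w) = h w v (x + t' n *\<^sub>R v + s' n *\<^sub>R w)"
    by metis
  have squeeze: "a \<longlonglongrightarrow> 0" if "\<And>n. 0 < a n \<and> a n < e n" for a
  proof (rule tendsto_sandwich[OF _ _ tendsto_const e_lim])
    have "0 \<le> a n \<and> a n \<le> e n" for n using that[of n] by simp
    then show "\<forall>\<^sub>F n in sequentially. 0 \<le> a n" "\<forall>\<^sub>F n in sequentially. a n \<le> e n"
      by simp_all
  qed
  have lim: "(\<lambda>n. x + a n *\<^sub>R v + b n *\<^sub>R w) \<longlonglongrightarrow> x"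
    if "\<And>n. 0 < a n \<and> a n < e n" "\<And>n. 0 < b n \<and> b n < e n" for a b
  proof -
    have "(\<lambda>n. x + a n *\<^sub>R v + b n *\<^sub>R w) \<longlonglongrightarrow> x + 0 *\<^sub>R v + 0 *\<^sub>R w"
      by (intro tendsto_intros squeeze that)
    then show ?thesis by simp
  qed
  have lim': "(\<lambda>n. h v' w' (x + a n *\<^sub>R v + b n *\<^sub>R w)) \<longlonglongrightarrow> h v' w' x"
    if "\<And>n. 0 < a n \<and> a n < e n" "\<And>n. 0 < b n \<and> b n < e n" for a b v' w'
    using that d3[of v' w'] assms(1,2) lim[OF that]
    by (metis continuous_on_eq_continuous_at isCont_tendsto_compose)
  have "(\<lambda>n. h v w (x + s n *\<^sub>R v + t n *\<^sub>R w)) \<longlonglongrightarrow> h v w x" by (rule lim') (use q in auto)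
  moreover have "(\<lambda>n. h v w (x + s n *\<^sub>R v + t n *\<^sub>R w)) \<longlonglongrightarrow> h w v x"
    unfolding q(2) by (rule lim') (use q in auto)
  ultimately have "h v w x = h w v x" by (rule LIMSEQ_unique)
  then show ?thesis by (simp add: h_def)
qed

section \<open>The spectral theorem and square roots\<close>

text \<open>Symmetry and invariance are relative to \<open>S\<close>, so that the notion restricts
  to the orthogonal complement of an eigenvector inside \<open>S\<close>.\<close>

definition selfadjoint_on :: "'a::real_inner set \<Rightarrow> ('a \<Rightarrow> 'a) \<Rightarrow> bool" where
  "selfadjoint_on S T \<longleftrightarrow> linear T \<and> T ` S \<subseteq> S \<and> (\<forall>x\<in>S. \<forall>y\<in>S. T x \<bullet> y = x \<bullet> T y)"

text \<open>A unit vector maximising the Rayleigh quotient is an eigenvector: the quadratic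
  polynomial \<open>t \<mapsto> \<lambda> |x + t y|\<^sup>2 - T (x + t y) \<bullet> (x + t y)\<close> is nonnegative and vanishes at 0.\<close>

lemma rayleigh_eigenvector:
  fixes T :: "'a::euclidean_space \<Rightarrow> 'a"
  assumes "subspace S" "selfadjoint_on S T" "S \<noteq> {0}"
  obtains x l where "x \<in> S" "norm x = 1" "T x = l *\<^sub>R x"
proof -
  have lin: "linear T" and TS: "\<And>x. x \<in> S \<Longrightarrow> T x \<in> S"
    and sym: "\<And>x y. x \<in> S \<Longrightarrow> y \<in> S \<Longrightarrow> T x \<bullet> y = x \<bullet> T y"
    using assms(2) by (auto simp: selfadjoint_on_def)
  let ?K = "S \<inter> sphere 0 1"
  have "compact ?K"
    using closed_Int_compact[OF closed_subspace[OF assms(1)] compact_sphere] .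
  moreover obtain a where "a \<in> S" "a \<noteq> 0" using assms(1,3) subspace_0 by blast
  then have "a /\<^sub>R norm a \<in> ?K" using assms(1) by (simp add: subspace_scale)
  moreover have "continuous_on ?K (\<lambda>x. T x \<bullet> x)"
    using lin by (intro continuous_intros linear_continuous_on) (simp add: linear_linear)
  ultimately obtain x where x: "x \<in> ?K" and max: "\<And>y. y \<in> ?K \<Longrightarrow> T y \<bullet> y \<le> T x \<bullet> x"
    using continuous_attains_sup[of ?K "\<lambda>x. T x \<bullet> x"] by blast
  define l where "l = T x \<bullet> x"
  have xx: "x \<bullet> x = 1" "x \<in> S" using x by (auto simp: dot_square_norm)
  have le: "T y \<bullet> y \<le> l * (y \<bullet> y)" if "y \<in> S" for y
  proof (cases "y = 0")
    case False
    then have "y /\<^sub>R norm y \<in> ?K" using assms(1) that by (simp add: subspace_scale)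
    from max[OF this] have "T y \<bullet> y / (norm y)\<^sup>2 \<le> l"
      by (simp add: l_def linear_scale[OF lin] power2_eq_square divide_inverse mult_ac)
    then show ?thesis using False by (simp add: dot_square_norm divide_le_eq)
  qed (simp add: linear_0[OF lin])
  have "T x = l *\<^sub>R x"
  proof -
    define y where "y = T x - l *\<^sub>R x"
    have yS: "y \<in> S" using assms(1) TS xx by (simp add: y_def subspace_diff subspace_scale)
    have xy: "T x \<bullet> y = y \<bullet> y + l * (x \<bullet> y)" by (simp add: y_def algebra_simps)
    define c where "c = l * (y \<bullet> y) - T y \<bullet> y"
    have c: "c \<ge> 0" using le[OF yS] by (simp add: c_def)
    \<comment> \<open>The Rayleigh bound at \<open>x + t *\<^sub>R y\<close> is an equality at
      \<open>t = 0\<close>. Its linear coefficient is \<open>2 * (y \<bullet> y)\<close> because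
      \<open>y\<close> is the residual \<open>T x - l *\<^sub>R x\<close>.\<close>
    have q: "2 * t * (y \<bullet> y) \<le> t\<^sup>2 * c" for t
    proof -
      have "x + t *\<^sub>R y \<in> S" using assms(1) xx yS by (simp add: subspace_add subspace_scale)
      from le[OF this]
      have "T x \<bullet> x + t * (T x \<bullet> y) + t * (T y \<bullet> x) + t\<^sup>2 * (T y \<bullet> y)
          \<le> l * (1 + 2 * t * (x \<bullet> y) + t\<^sup>2 * (y \<bullet> y))"
        using xx by (simp add: linear_add[OF lin] linear_scale[OF lin] algebra_simps inner_commute power2_eq_square)
      moreover have "T y \<bullet> x = T x \<bullet> y" using sym[OF yS xx(2)] by (simp add: inner_commute)
      ultimately show ?thesis by (simp add: xy l_def[symmetric] c_def algebra_simps)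
    qed
    have "y \<bullet> y \<le> 0"
    proof (rule ccontr)
      define Y where "Y = y \<bullet> y"
      assume "\<not> y \<bullet> y \<le> 0"
      then have Y: "Y > 0" by (simp only: Y_def not_le)
      \<comment> \<open>For small positive \<open>t\<close> the linear term outweighs
        \<open>t\<^sup>2 * c\<close>; the 1 in the denominator allows \<open>c = 0\<close>.\<close>
      define t where "t = Y / (c + 1)"
      have t: "t > 0" using Y c unfolding t_def by (intro divide_pos_pos) auto
      have "2 * t * Y \<le> t\<^sup>2 * c" using q[of t] by (simp only: Y_def)
      then have "2 * Y \<le> t * c" using t by (simp add: power2_eq_square)
      also have "\<dots> \<le> Y" using Y c by (simp add: t_def divide_le_eq)
      finally show False using Y by simp
    qed
    then have "y = 0" by (metis inner_eq_zero_iff inner_ge_zero order_antisym)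
    then show ?thesis by (simp add: y_def)
  qed
  moreover have "norm x = 1" using x by simp
  ultimately show thesis using that xx(2) by blast
qed

text \<open>Induction on the dimension: symmetry makes the orthogonal complement of an eigenvector
  invariant, and that complement is a proper subspace.\<close>

theorem selfadjoint_orthonormal_eigenbasis:
  fixes T :: "'a::euclidean_space \<Rightarrow> 'a"
  assumes "subspace S" "selfadjoint_on S T"
  shows "\<exists>B. B \<subseteq> S \<and> pairwise orthogonal B \<and> (\<forall>b\<in>B. norm b = 1 \<and> (\<exists>l. T b = l *\<^sub>R b)) \<and>
           card B = dim S \<and> span B = S"
  using assms
proof (induction "dim S" arbitrary: S rule: less_induct)
  case less
  show ?case
  proof (cases "S = {0}")
    case True
    then show ?thesis by (intro exI[of _ "{}"]) auto
  next
    case False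
    obtain x l where x: "x \<in> S" "norm x = 1" "T x = l *\<^sub>R x"
      using rayleigh_eigenvector[OF less.prems False] by metis
    define S' where "S' = {y\<in>S. x \<bullet> y = 0}"
    have xx: "x \<bullet> x = 1" using x(2) by (simp add: dot_square_norm)
    have sub: "subspace S'"
      using less.prems(1) by (auto simp: S'_def subspace_def inner_simps)
    have sa: "selfadjoint_on S' T"
    proof -
      have "x \<bullet> T y = 0" if "y \<in> S" "x \<bullet> y = 0" for y
      proof -
        have "x \<bullet> T y = T x \<bullet> y" using less.prems(2) x(1) that(1) by (simp add: selfadjoint_on_def)
        then show ?thesis using x(3) that(2) by simp
      qed
      then show ?thesis using less.prems(2) by (auto simp: S'_def selfadjoint_on_def)
    qed
    have "x \<notin> S'" using xx by (simp add: S'_def)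
    moreover have "S' \<subseteq> S" by (auto simp: S'_def)
    ultimately have "S' \<subset> S" using x(1) by blast
    then have "dim S' < dim S"
      using dim_psubset[of S' S] sub less.prems(1) by (metis span_eq_iff)
    then obtain B where B: "B \<subseteq> S'" "pairwise orthogonal B"
      "\<forall>b\<in>B. norm b = 1 \<and> (\<exists>l. T b = l *\<^sub>R b)" "span B = S'"
      using less.hyps[OF _ sub sa] by metis
    have xB: "\<forall>b\<in>B. x \<bullet> b = 0" using B(1) by (auto simp: S'_def)
    have po: "pairwise orthogonal (insert x B)"
      using B(2) xB by (auto simp: pairwise_insert orthogonal_def inner_commute)
    have "S \<subseteq> span (insert x B)"
    proof
      fix y assume y: "y \<in> S"
      have "y - (x \<bullet> y) *\<^sub>R x \<in> S'"
        using less.prems(1) x(1) y xx by (simp add: S'_def subspace_diff subspace_scale inner_simps)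
      then show "y \<in> span (insert x B)" using B(4) span_breakdown_eq by blast
    qed
    moreover have "insert x B \<subseteq> S" using x(1) B(1) by (auto simp: S'_def)
    ultimately have sp: "span (insert x B) = S"
      using less.prems(1) span_minimal by blast
    have "0 \<notin> insert x B" using x(2) B(3) by auto
    then have "card (insert x B) = dim S"
      using pairwise_orthogonal_independent[OF po] sp by (metis dim_eq_card_independent dim_span)
    moreover have "\<forall>b\<in>insert x B. norm b = 1 \<and> (\<exists>l. T b = l *\<^sub>R b)"
      using B(3) x(2,3) by blast
    ultimately show ?thesis using po sp \<open>insert x B \<subseteq> S\<close> by blast
  qed
qed

text \<open>The eigenvectors are indexed by the coordinate type itself, so that they can serve as
  columns of a square matrix.\<close>

corollary symmetric_orthonormal_eigenvectors:
  fixes T :: "real^'n \<Rightarrow> real^'n"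
  assumes "linear T" "\<And>x y. T x \<bullet> y = x \<bullet> T y"
  obtains u :: "'n \<Rightarrow> real^'n" and l :: "'n \<Rightarrow> real" where
    "\<And>i j. u i \<bullet> u j = (if i = j then 1 else 0)" "\<And>i. T (u i) = l i *\<^sub>R u i"
    "\<And>x. x = (\<Sum>i\<in>UNIV. (u i \<bullet> x) *\<^sub>R u i)"
proof -
  have "selfadjoint_on UNIV T" using assms by (simp add: selfadjoint_on_def)
  from selfadjoint_orthonormal_eigenbasis[OF subspace_UNIV this]
  obtain B where B: "pairwise orthogonal B" "\<forall>b\<in>B. norm b = 1 \<and> (\<exists>l. T b = l *\<^sub>R b)"
    "card B = CARD('n)" "span B = UNIV"
    by (auto simp: dim_UNIV)
  have "finite B" using B(3) card_ge_0_finite[of B] by simp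
  then obtain u :: "'n \<Rightarrow> real^'n" where u: "bij_betw u UNIV B"
    using finite_same_card_bij[of "UNIV :: 'n set" B] B(3) by auto
  have uB: "u i \<in> B" for i using u by (auto simp: bij_betw_def)
  have on: "u i \<bullet> u j = (if i = j then 1 else 0)" for i j
  proof (cases "i = j")
    case True
    then show ?thesis using B(2) uB[of j] by (simp add: dot_square_norm)
  next
    case False
    then have "u i \<noteq> u j" using u by (simp add: bij_betw_def inj_eq)
    then show ?thesis using False B(1) uB by (simp add: pairwise_def orthogonal_def)
  qed
  have "\<forall>i. \<exists>l. T (u i) = l *\<^sub>R u i" using B(2) uB by blast
  then obtain l where l: "\<And>i. T (u i) = l i *\<^sub>R u i" by (auto dest!: choice)
  have "x = (\<Sum>i\<in>UNIV. (u i \<bullet> x) *\<^sub>R u i)" for x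
  proof -
    have "x = (\<Sum>b\<in>B. (b \<bullet> x) *\<^sub>R b)"
      using orthonormal_basis_expand[of B x] B \<open>finite B\<close> by (simp add: inner_commute[of x])
    then show ?thesis using sum.reindex_bij_betw[OF u, of "\<lambda>b. (b \<bullet> x) *\<^sub>R b"] by simp
  qed
  then show thesis using that on l by blast
qed

text \<open>From \<open>P P = Q Q\<close> follows \<open>P (P - Q) = - (P - Q) Q\<close>. On an
  eigenvector \<open>b\<close> of the symmetric map \<open>P - Q\<close> with eigenvalue
  \<open>l\<close> this reads \<open>l * (P b \<bullet> b) = - l * (Q b \<bullet> b)\<close>, and
  positivity forces \<open>l = 0\<close>.\<close>

lemma positive_square_root_unique:
  fixes P Q :: "'a::euclidean_space \<Rightarrow> 'a"
  assumes "linear P" "\<And>x y. P x \<bullet> y = x \<bullet> P y" "\<And>x. x \<noteq> 0 \<Longrightarrow> P x \<bullet> x > 0"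
    and "linear Q" "\<And>x y. Q x \<bullet> y = x \<bullet> Q y" "\<And>x. x \<noteq> 0 \<Longrightarrow> Q x \<bullet> x > 0"
    and sq: "\<And>x. P (P x) = Q (Q x)"
  shows "P = Q"
proof -
  let ?D = "\<lambda>x. P x - Q x"
  have lin: "linear ?D" using assms(1,4) by (rule linear_compose_sub)
  have "selfadjoint_on UNIV ?D"
    using lin assms(2,5) by (simp add: selfadjoint_on_def inner_diff_left inner_diff_right)
  from selfadjoint_orthonormal_eigenbasis[OF subspace_UNIV this]
  obtain B where B: "\<forall>b\<in>B. norm b = 1 \<and> (\<exists>l. ?D b = l *\<^sub>R b)" "span B = (UNIV :: 'a set)"
    by blast
  have "?D b = 0" if b: "b \<in> B" for b
  proof -
    obtain l where l: "P b - Q b = l *\<^sub>R b" "b \<noteq> 0" using B(1) b by fastforce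
    have "l * (P b \<bullet> b) = P (P b - Q b) \<bullet> b"
      by (simp add: l linear_scale[OF assms(1)])
    also have "\<dots> = (Q (Q b) - P (Q b)) \<bullet> b" by (simp add: linear_diff[OF assms(1)] sq)
    also have "\<dots> = Q b \<bullet> (Q b - P b)" using assms(2,5) by (simp add: algebra_simps)
    also have "\<dots> = Q b \<bullet> (- (l *\<^sub>R b))" using l(1) by (metis minus_diff_eq)
    also have "\<dots> = - l * (Q b \<bullet> b)" by simp
    finally have "l * (P b \<bullet> b + Q b \<bullet> b) = 0" by (simp add: algebra_simps)
    then have "l = 0" using assms(3,6)[OF l(2)] by simp
    then show ?thesis using l by simp
  qed
  then have "?D x = 0" for x
    using linear_eq_on_span[OF lin linear_zero, of B x] B(2) by auto
  then show ?thesis by auto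
qed

section \<open>Polar decomposition of shears\<close>

definition adjoint_matrix :: "complex^'n^'m \<Rightarrow> complex^'m^'n" where
  "adjoint_matrix A = (\<chi> i j. cnj (A $ j $ i))"

lemma unitary_matrix_iff: "unitary_matrix U \<longleftrightarrow> adjoint_matrix U ** U = mat 1"
  by (simp add: unitary_matrix_def adjoint_matrix_def)

lemma adjoint_matrix_mult: "adjoint_matrix (A ** B) = adjoint_matrix B ** adjoint_matrix A"
  by (simp add: adjoint_matrix_def matrix_matrix_mult_def vec_eq_iff mult.commute)

lemma adjoint_matrix_adjoint_matrix [simp]: "adjoint_matrix (adjoint_matrix A) = A"
  by (simp add: adjoint_matrix_def vec_eq_iff)

lemma unitary_matrix_right: "unitary_matrix U \<Longrightarrow> U ** adjoint_matrix U = mat 1"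
  by (simp add: unitary_matrix_iff matrix_left_right_inverse)

lemma unitary_matrix_mult:
  assumes "unitary_matrix A" "unitary_matrix B" shows "unitary_matrix (A ** B)"
proof -
  have "adjoint_matrix (A ** B) ** (A ** B) = adjoint_matrix B ** (adjoint_matrix A ** A) ** B"
    by (simp add: adjoint_matrix_mult matrix_mul_assoc)
  then show ?thesis using assms by (simp add: unitary_matrix_iff)
qed

lemma unitary_matrix_adjoint: "unitary_matrix U \<Longrightarrow> unitary_matrix (adjoint_matrix U)"
  by (simp add: unitary_matrix_iff[of "adjoint_matrix U"] unitary_matrix_right)

lemma det_unitary_conjugate:
  assumes "unitary_matrix W" shows "det (W ** A ** adjoint_matrix W) = det A"
proof -
  have "det W * det (adjoint_matrix W) = 1"
    using unitary_matrix_right[OF assms] by (metis det_mul det_I)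
  then show ?thesis by (simp add: det_mul)
qed

lemma inner_complex_vec: "x \<bullet> y = Re (\<Sum>i\<in>UNIV. cnj (x $ i) * y $ i)" for x y :: "complex^'n"
  by (simp add: inner_vec_def inner_complex_def)

text \<open>The real inner product is the real part of the Hermitian one, so the conjugate transpose
  is also the adjoint over the reals.\<close>

lemma inner_adjoint_matrix:
  fixes A :: "complex^'n^'m"
  shows "(A *v x) \<bullet> y = x \<bullet> (adjoint_matrix A *v y)"
proof -
  have "(\<Sum>i\<in>UNIV. cnj ((A *v x) $ i) * y $ i) =
      (\<Sum>i\<in>UNIV. \<Sum>j\<in>UNIV. cnj (A $ i $ j) * cnj (x $ j) * y $ i)"
    by (simp add: matrix_vector_mult_def sum_distrib_right)
  also have "\<dots> = (\<Sum>j\<in>UNIV. \<Sum>i\<in>UNIV. cnj (A $ i $ j) * cnj (x $ j) * y $ i)"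
    by (rule sum.swap)
  also have "\<dots> = (\<Sum>j\<in>UNIV. cnj (x $ j) * (adjoint_matrix A *v y) $ j)"
    by (simp add: matrix_vector_mult_def adjoint_matrix_def sum_distrib_left mult_ac)
  finally show ?thesis by (simp add: inner_complex_vec)
qed

lemma inner_unitary:
  assumes "unitary_matrix U" shows "(U *v x) \<bullet> (U *v y) = x \<bullet> y"
  using assms by (simp add: inner_adjoint_matrix matrix_vector_mul_assoc unitary_matrix_iff)

text \<open>Unitary factors preserve the inner product, so \<open>P\<close> and \<open>Q\<close> are
  both positive square roots of the adjoint of \<open>A\<close> composed with \<open>A\<close>.
  Being injective, the common root is onto, and the unitary factors agree everywhere.\<close>

lemma polar_decomposition_unitary_unique:
  assumes "polar_decomposition A U P" "polar_decomposition A V Q"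
  shows "U = V"
proof -
  have U: "unitary_matrix U" "unitary_matrix V" "linear P" "linear Q"
    and sym: "\<And>x y. P x \<bullet> y = x \<bullet> P y" "\<And>x y. Q x \<bullet> y = x \<bullet> Q y"
    and pos: "\<And>x. x \<noteq> 0 \<Longrightarrow> P x \<bullet> x > 0" "\<And>x. x \<noteq> 0 \<Longrightarrow> Q x \<bullet> x > 0"
    and A: "\<And>v. A v = U *v P v" "\<And>v. A v = V *v Q v"
    using assms unfolding polar_decomposition_def by auto
  have "P (P x) = Q (Q x)" for x
  proof -
    have "y \<bullet> (P (P x)) = y \<bullet> (Q (Q x))" for y
    proof -
      have "y \<bullet> (P (P x)) = P y \<bullet> P x" by (simp add: sym)
      also have "\<dots> = A y \<bullet> A x" by (simp add: A(1) inner_unitary[OF U(1)])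
      also have "\<dots> = Q y \<bullet> Q x" by (simp add: A(2) inner_unitary[OF U(2)])
      finally show ?thesis by (simp add: sym)
    qed
    then show ?thesis by (metis inner_commute vector_eq_rdot)
  qed
  then have PQ: "P = Q"
    using positive_square_root_unique[OF U(3) sym(1) pos(1) U(4) sym(2) pos(2)] by blast
  have "inj P"
  proof (rule injI)
    fix x y assume "P x = P y"
    then have "P (x - y) \<bullet> (x - y) = 0" by (simp add: linear_diff[OF U(3)])
    then show "x = y" using pos(1)[of "x - y"] by fastforce
  qed
  then have "surj P" using linear_injective_imp_surjective[OF U(3)] by simp
  have "U *v x = V *v x" for x
    using A PQ surjD[OF \<open>surj P\<close>, of x] by metis
  then show ?thesis by (simp add: matrix_eq)
qed

lemma unitary_part_eq:
  assumes "polar_decomposition A U P" shows "unitary_part A = U"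
  unfolding unitary_part_def
  using assms polar_decomposition_unitary_unique by blast

section \<open>Planar shears and their products\<close>

definition shear :: "real \<Rightarrow> complex \<Rightarrow> complex" where
  "shear s c = c + \<i> * of_real (s * Re c)"

text \<open>This is \<open>shear s c\<close> rotated back by the angle \<open>a\<close>, in real
  coordinates. The off-diagonal entries are \<open>sin a\<close> and
  \<open>s * cos a - sin a\<close>; they coincide exactly when \<open>tan a = s / 2\<close>, whence
  the angle.\<close>

definition shear_positive_part :: "real \<Rightarrow> complex \<Rightarrow> complex" where
  "shear_positive_part s c = (let a = arctan (s / 2) in
     Complex ((cos a + s * sin a) * Re c + sin a * Im c) (sin a * Re c + cos a * Im c))"

lemma sin_arctan_eq: "sin (arctan (s / 2)) = cos (arctan (s / 2)) * s / 2"
  by (simp add: sin_arctan cos_arctan)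

lemma shear_polar: "cis (arctan (s / 2)) * shear_positive_part s c = shear s c"
proof -
  define C S where "C = cos (arctan (s / 2))" and "S = sin (arctan (s / 2))"
  have S: "S = C * s / 2" and 1: "C * C + S * S = 1"
    using sin_arctan_eq[of s] sin_cos_squared_add3[of "arctan (s / 2)"] by (simp_all add: C_def S_def)
  have "C * ((C + s * S) * x + S * y) - S * (S * x + C * y) = (C * C + S * S) * x" for x y
    by (simp add: S algebra_simps)
  moreover have "C * (S * x + C * y) + S * ((C + s * S) * x + S * y) = (C * C + S * S) * (y + s * x)" for x y
    by (simp add: S algebra_simps)
  ultimately show ?thesis
    using 1 by (simp add: complex_eq_iff shear_def shear_positive_part_def Let_def C_def[symmetric] S_def[symmetric])
qed

lemma shear_positive_part_add:
  "shear_positive_part s (b + c) = shear_positive_part s b + shear_positive_part s c"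
  by (simp add: shear_positive_part_def Let_def complex_eq_iff algebra_simps)

lemma shear_positive_part_scaleR:
  "shear_positive_part s (r *\<^sub>R c) = r *\<^sub>R shear_positive_part s c"
  by (simp add: shear_positive_part_def Let_def complex_eq_iff algebra_simps)

lemma shear_positive_part_symmetric:
  "shear_positive_part s b \<bullet> c = b \<bullet> shear_positive_part s c"
  by (simp add: shear_positive_part_def Let_def inner_complex_def algebra_simps)

text \<open>With \<open>C\<close> and \<open>S\<close> the cosine and sine of the angle,
  \<open>C > 0\<close>, and completing the square after multiplication by \<open>C\<close> gives
  \<open>(S * x + C * y)\<^sup>2 + x\<^sup>2\<close>.\<close>

lemma shear_positive_part_pos:
  assumes "c \<noteq> 0" shows "shear_positive_part s c \<bullet> c > 0"
proof -
  define C S where "C = cos (arctan (s / 2))" and "S = sin (arctan (s / 2))"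
  define x y where "x = Re c" and "y = Im c"
  have S: "S = C * s / 2" and 1: "C * C + S * S = 1"
    using sin_arctan_eq[of s] sin_cos_squared_add3[of "arctan (s / 2)"] by (simp_all add: C_def S_def)
  have C: "C > 0" by (simp add: C_def cos_arctan add_pos_nonneg)
  have "C * (shear_positive_part s c \<bullet> c) = (S * x + C * y)\<^sup>2 + (C * C + S * S) * x\<^sup>2"
    by (simp add: shear_positive_part_def Let_def inner_complex_def C_def[symmetric] S_def[symmetric]
        x_def[symmetric] y_def[symmetric] S power2_eq_square algebra_simps)
  then have eq: "C * (shear_positive_part s c \<bullet> c) = (S * x + C * y)\<^sup>2 + x\<^sup>2" by (simp add: 1)
  have "x \<noteq> 0 \<or> y \<noteq> 0" using assms by (auto simp: x_def y_def complex_eq_iff)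
  then have "(S * x + C * y)\<^sup>2 + x\<^sup>2 > 0"
    using C by (cases "x = 0") (auto simp: add_nonneg_pos)
  then show ?thesis using eq C by (metis zero_less_mult_pos)
qed

text \<open>A unitary factor on the left goes into the unitary part, and unitary conjugation
  respects both factors, so the coordinatewise decompositions assemble into one of \<open>A\<close>.
  The conjugation cancels in the determinant.\<close>

lemma det_unitary_part_shear:
  fixes A :: "complex^'n \<Rightarrow> complex^'n"
  assumes "unitary_matrix D" "unitary_matrix W"
    and A: "\<And>v. A v = D *v (W *v (\<chi> k. shear (s k) ((adjoint_matrix W *v v) $ k)))"
  shows "det (unitary_part A) = det D * (\<Prod>k\<in>UNIV. cis (arctan (s k / 2)))"
proof -
  \<comment> \<open>Only the rotations form a complex matrix; the positive factor \<open>p\<close>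
    is merely real linear and therefore stays a function.\<close>
  define E :: "complex^'n^'n" where "E = (\<chi> i j. if i = j then cis (arctan (s i / 2)) else 0)"
  define p :: "complex^'n \<Rightarrow> complex^'n" where "p v = (\<chi> k. shear_positive_part (s k) (v $ k))" for v
  define P where "P v = W *v p (adjoint_matrix W *v v)" for v
  define U where "U = D ** (W ** E ** adjoint_matrix W)"
  have Ev: "E *v p v = (\<chi> k. shear (s k) (v $ k))" for v
    by (simp add: E_def p_def matrix_vector_mult_def vec_eq_iff shear_polar[symmetric]
        if_distrib[where f = "\<lambda>x. x * _"] cong: if_cong)
  have E: "unitary_matrix E"
    by (simp add: unitary_matrix_iff E_def adjoint_matrix_def matrix_matrix_mult_def vec_eq_iff mat_def
        if_distrib[where f = "\<lambda>x. x * _"] if_distrib[where f = cnj] cis_cnj cis_mult cong: if_cong)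
  have WW: "adjoint_matrix W ** W = mat 1" "W ** adjoint_matrix W = mat 1"
    using assms(2) unitary_matrix_right by (auto simp: unitary_matrix_iff)
  have "polar_decomposition A U P"
    unfolding polar_decomposition_def
  proof (intro conjI allI impI)
    show "unitary_matrix U"
      unfolding U_def using assms E by (intro unitary_matrix_mult unitary_matrix_adjoint)
    have padd: "p (v + w) = p v + p w" and pscale: "p (r *\<^sub>R v) = r *\<^sub>R p v" for v w r
      by (simp_all add: p_def vec_eq_iff shear_positive_part_add shear_positive_part_scaleR)
    have sc: "M *v (r *\<^sub>R v) = r *\<^sub>R (M *v v)" for M :: "complex^'n^'n" and v r
      by (simp add: matrix_vector_mult_def vec_eq_iff scaleR_sum_right)
    show "linear P"
      by (rule linearI) (simp_all add: P_def matrix_vector_right_distrib padd pscale sc)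
    have psym: "p v \<bullet> w = v \<bullet> p w" for v w
      by (simp add: p_def inner_vec_def shear_positive_part_symmetric)
    show "P v \<bullet> w = v \<bullet> P w" for v w
      using inner_adjoint_matrix[of "adjoint_matrix W" v "p (adjoint_matrix W *v w)"]
      by (simp add: P_def inner_adjoint_matrix[of W] psym)
    show "P v \<bullet> v > 0" if "v \<noteq> 0" for v
    proof -
      define w where "w = adjoint_matrix W *v v"
      have "W *v w = v" by (simp add: w_def matrix_vector_mul_assoc WW)
      then have "w \<noteq> 0" using that by auto
      then obtain k where k: "w $ k \<noteq> 0" by (auto simp: vec_eq_iff)
      have "0 \<le> shear_positive_part (s i) (w $ i) \<bullet> w $ i" for i
        using shear_positive_part_pos[of "w $ i" "s i"] by (cases "w $ i = 0") auto
      then have "p w \<bullet> w > 0"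
        unfolding inner_vec_def p_def
        by (intro sum_pos2[where i = k]) (use k shear_positive_part_pos in auto)
      then show ?thesis by (simp add: P_def inner_adjoint_matrix w_def)
    qed
    show "A v = U *v P v" for v
    proof -
      have "U *v P v = D *v (W *v (E *v ((adjoint_matrix W ** W) *v p (adjoint_matrix W *v v))))"
        by (simp only: U_def P_def matrix_vector_mul_assoc matrix_mul_assoc)
      then show ?thesis by (simp add: WW A Ev)
    qed
  qed
  then have "unitary_part A = U" by (rule unitary_part_eq)
  moreover have "det E = (\<Prod>k\<in>UNIV. cis (arctan (s k / 2)))"
    by (subst det_diagonal) (simp_all add: E_def)
  ultimately show ?thesis by (simp add: U_def det_mul[of D] det_unitary_conjugate[OF assms(2)])
qed

section \<open>The moment map and Lebesgue measure\<close>

lemma borel_measurable_vec_lambda [measurable (raw)]: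
  fixes f :: "'a \<Rightarrow> 'n::finite \<Rightarrow> 'b::euclidean_space"
  assumes "\<And>i. (\<lambda>x. f x i) \<in> borel_measurable M"
  shows "(\<lambda>x. \<chi> i. f x i) \<in> borel_measurable M"
  using assms by (subst borel_measurable_euclidean_space) (auto simp: Basis_vec_def inner_axis)

lemma borel_measurable_vec_nth [measurable (raw)]:
  fixes f :: "'a \<Rightarrow> 'b::euclidean_space^'n::finite"
  assumes "f \<in> borel_measurable M"
  shows "(\<lambda>x. f x $ i) \<in> borel_measurable M"
  by (rule measurable_compose[OF assms borel_measurable_continuous_onI]) (intro continuous_intros)

lemma prod_Basis_vec:
  fixes g :: "('a::euclidean_space)^'n::finite \<Rightarrow> 'c::comm_monoid_mult"
  shows "(\<Prod>b\<in>Basis. g b) = (\<Prod>i\<in>UNIV. \<Prod>b\<in>Basis. g (axis i b))"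
proof -
  have "bij_betw (\<lambda>(i, b). axis i b) ((UNIV :: 'n set) \<times> (Basis :: 'a set)) Basis"
    by (auto simp: bij_betw_def inj_on_def axis_eq_axis Basis_vec_def image_def)
  from prod.reindex_bij_betw[OF this, of g] show ?thesis
    by (simp add: prod.cartesian_product split_def)
qed

text \<open>Lebesgue measure is characterised by its values on boxes, and a box in the vector space
  is a product of boxes. The entries are arbitrary Euclidean spaces because both
  \<open>complex\<close> and \<open>real\<close> occur.\<close>

lemma lborel_vec:
  "(lborel :: (('a::euclidean_space)^'n::finite) measure) =
     distr (\<Pi>\<^sub>M i\<in>UNIV. lborel) borel (\<lambda>f. \<chi> i. f i)"
proof (rule lborel_eqI)
  interpret product_sigma_finite "\<lambda>_::'n. lborel :: 'a measure"
    by unfold_locales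
  fix l u :: "'a^'n" assume le: "\<And>b. b \<in> Basis \<Longrightarrow> l \<bullet> b \<le> u \<bullet> b"
  have le': "l $ i \<bullet> b \<le> u $ i \<bullet> b" if "b \<in> Basis" for i b
    using le[of "axis i b"] that by (simp add: inner_axis axis_in_Basis_iff)
  have "emeasure (distr (\<Pi>\<^sub>M i\<in>UNIV. lborel) borel (\<lambda>f. \<chi> i. f i)) (box l u) =
      emeasure (\<Pi>\<^sub>M i\<in>UNIV. lborel) (\<Pi>\<^sub>E i\<in>UNIV. box (l $ i) (u $ i))"
    by (subst emeasure_distr)
       (auto intro!: arg_cong2[where f = emeasure] simp: space_PiM box_def Basis_vec_def inner_axis PiE_def Pi_def)
  also have "\<dots> = (\<Prod>i\<in>UNIV. emeasure lborel (box (l $ i) (u $ i)))"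
    by (rule emeasure_PiM) auto
  also have "\<dots> = (\<Prod>i\<in>UNIV. ennreal (\<Prod>b\<in>Basis. (u $ i - l $ i) \<bullet> b))"
    by (simp add: emeasure_lborel_box le')
  also have "\<dots> = ennreal (\<Prod>i\<in>UNIV. \<Prod>b\<in>Basis. (u $ i - l $ i) \<bullet> b)"
    by (rule prod_ennreal) (auto intro!: prod_nonneg simp: inner_diff_left le')
  finally show "emeasure (distr (\<Pi>\<^sub>M i\<in>UNIV. lborel) borel (\<lambda>f. \<chi> i. f i)) (box l u) =
      ennreal (\<Prod>b\<in>Basis. (u - l) \<bullet> b)"
    by (simp add: prod_Basis_vec inner_axis)
qed simp

lemma emeasure_lborel_vec:
  fixes A :: "'n::finite \<Rightarrow> 'a::euclidean_space set"
  assumes "\<And>i. A i \<in> sets borel"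
  shows "emeasure lborel {x. \<forall>i. x $ i \<in> A i} = (\<Prod>i\<in>UNIV. emeasure lborel (A i))"
proof -
  interpret product_sigma_finite "\<lambda>_::'n. lborel :: 'a measure"
    by unfold_locales
  have "{x. \<forall>i. x $ i \<in> A i} = (\<Inter>i. (\<lambda>x. x $ i) -` A i \<inter> space (borel :: ('a^'n) measure))"
    by auto
  also have "\<dots> \<in> sets borel"
    by (intro sets.finite_INT measurable_sets[OF borel_measurable_vec_nth assms]) auto
  finally have "emeasure lborel {x. \<forall>i. x $ i \<in> A i} = emeasure (\<Pi>\<^sub>M i\<in>UNIV. lborel) (\<Pi>\<^sub>E i\<in>UNIV. A i)"
    by (subst lborel_vec, subst emeasure_distr)
       (auto intro!: arg_cong2[where f = emeasure] simp: space_PiM PiE_def Pi_def)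
  also have "\<dots> = (\<Prod>i\<in>UNIV. emeasure lborel (A i))"
    by (rule emeasure_PiM) (use assms in auto)
  finally show ?thesis .
qed

text \<open>A disc of radius \<open>r\<close> has area \<open>pi * r\<^sup>2\<close>, so the
  quantity \<open>pi * (cmod c)\<^sup>2\<close> is the area it encloses: the one-dimensional case of
  \<open>distr_moment_map\<close>.\<close>

lemma emeasure_complex_annulus:
  "emeasure lborel {c::complex. a < pi * (cmod c)\<^sup>2 \<and> pi * (cmod c)\<^sup>2 < b} =
   emeasure lborel ({0..} \<inter> {a<..<b})"
proof -
  define r where "r t = sqrt (t / pi)" for t
  have r: "r t \<ge> 0" "pi * (r t)\<^sup>2 = t" if "t \<ge> 0" for t using that by (simp_all add: r_def)
  have lt: "pi * (cmod c)\<^sup>2 < t \<longleftrightarrow> c \<in> ball 0 (r t)" if "t \<ge> 0" for t c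
  proof -
    have "pi * (cmod c)\<^sup>2 < t \<longleftrightarrow> (cmod c)\<^sup>2 < t / pi" by (simp add: pos_less_divide_eq mult.commute)
    also have "\<dots> \<longleftrightarrow> sqrt ((cmod c)\<^sup>2) < r t" by (simp only: r_def real_sqrt_less_iff)
    finally show ?thesis by simp
  qed
  have le: "pi * (cmod c)\<^sup>2 \<le> t \<longleftrightarrow> c \<in> cball 0 (r t)" if "t \<ge> 0" for t c
  proof -
    have "pi * (cmod c)\<^sup>2 \<le> t \<longleftrightarrow> (cmod c)\<^sup>2 \<le> t / pi" by (simp add: pos_le_divide_eq mult.commute)
    also have "\<dots> \<longleftrightarrow> sqrt ((cmod c)\<^sup>2) \<le> r t" by (simp only: r_def real_sqrt_le_iff)
    finally show ?thesis by simp
  qed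
  have ball: "emeasure lborel (ball (0::complex) (r t)) = ennreal t" if "t \<ge> 0" for t
    using r[OF that] by (simp add: emeasure_ball unit_ball_vol_2)
  have cball: "emeasure lborel (cball (0::complex) (r t)) = ennreal t" if "t \<ge> 0" for t
    using r[OF that] by (simp add: emeasure_cball unit_ball_vol_2)
  \<comment> \<open>Arbitrary boxes allow negative \<open>a\<close> and \<open>b\<close>: the set is
    empty, a disc, or a disc minus a smaller closed disc.\<close>
  consider "b \<le> 0 \<or> b \<le> a" | "a < 0" "0 < b" | "0 \<le> a" "a < b" by linarith
  then show ?thesis
  proof cases
    case 1
    have no: "\<not> (a < t \<and> t < b)" if "0 \<le> t" for t using 1 that by (elim disjE) linarith+
    have "{c::complex. a < pi * (cmod c)\<^sup>2 \<and> pi * (cmod c)\<^sup>2 < b} = {}"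
      using no[of "pi * (cmod c)\<^sup>2" for c] by simp
    moreover have "{0..} \<inter> {a<..<b} = {}" using no by auto
    ultimately show ?thesis by (simp only: emeasure_empty)
  next
    case 2
    have "a < pi * (cmod c)\<^sup>2" for c using 2(1) by (meson less_le_trans mult_nonneg_nonneg pi_ge_zero zero_le_power2)
    then have "{c::complex. a < pi * (cmod c)\<^sup>2 \<and> pi * (cmod c)\<^sup>2 < b} = ball 0 (r b)"
      using lt[of b] 2(2) by auto
    moreover have "{0..} \<inter> {a<..<b} = {0..<b}" using 2 by auto
    ultimately show ?thesis using ball[of b] 2(2) by simp
  next
    case 3
    have "{c::complex. a < pi * (cmod c)\<^sup>2 \<and> pi * (cmod c)\<^sup>2 < b} = ball 0 (r b) - cball 0 (r a)"
      using lt[of b] le[of a] 3 by (auto simp: not_le[symmetric])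
    moreover have "emeasure lborel (ball (0::complex) (r b) - cball 0 (r a)) = ennreal b - ennreal a"
    proof (subst emeasure_Diff)
      show "cball 0 (r a) \<subseteq> ball (0::complex) (r b)"
      proof
        fix c :: complex assume "c \<in> cball 0 (r a)"
        then have "pi * (cmod c)\<^sup>2 \<le> a" using le[OF 3(1)] by blast
        then have "pi * (cmod c)\<^sup>2 < b" using 3(2) by linarith
        then show "c \<in> ball 0 (r b)" using lt[of b c] 3 by simp
      qed
    qed (use 3 in \<open>simp_all add: ball cball\<close>)
    moreover have "{0..} \<inter> {a<..<b} = {a<..<b}" using 3 by auto
    ultimately show ?thesis using 3 by (simp add: ennreal_minus)
  qed
qed

lemma closed_orthant: "closed (orthant :: (real^'n) set)"
proof -
  have "orthant = (\<Inter>i. {x :: real^'n. 0 \<le> x $ i})" by (auto simp: orthant_def)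
  moreover have "closed {x :: real^'n. 0 \<le> x $ i}" for i
    by (intro closed_Collect_le continuous_intros)
  ultimately show ?thesis using closed_INT[of UNIV "\<lambda>i. {x :: real^'n. 0 \<le> x $ i}"] by simp
qed

lemma continuous_on_moment_map: "continuous_on S moment_map"
  unfolding moment_map_def[abs_def]
  by (intro continuous_on_vec_lambda continuous_intros)

text \<open>On a box both sides factor over the coordinates into annulus areas and interval lengths.
  Boxes are stable under intersection, generate the Borel sets, and exhaust the space with finite
  measure.\<close>

lemma distr_moment_map:
  "distr lborel borel (moment_map :: complex^'n \<Rightarrow> real^'n) =
   density lborel (\<lambda>x. indicator orthant x)"
proof (rule measure_eqI_generator_eq)
  let ?E = "range (\<lambda>(a, b). box a b :: (real^'n) set)"
  let ?N = "distr lborel borel (moment_map :: complex^'n \<Rightarrow> real^'n)"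
  let ?M = "density lborel (\<lambda>x. indicator (orthant :: (real^'n) set) x)"
  have mm [measurable]: "(moment_map :: complex^'n \<Rightarrow> real^'n) \<in> borel_measurable borel"
    by (intro borel_measurable_continuous_onI continuous_on_moment_map)
  have [measurable]: "(orthant :: (real^'n) set) \<in> sets borel"
    using closed_orthant by (rule borel_closed)
  have bx: "x \<in> box a b \<longleftrightarrow> (\<forall>i. x $ i \<in> {a $ i<..<b $ i})" for a b x :: "real^'n"
    by (auto simp: mem_box_cart)
  have eq: "emeasure ?N (box a b) = emeasure ?M (box a b)" for a b
  proof -
    have "emeasure ?N (box a b) = emeasure lborel (moment_map -` box a b)"
      by (subst emeasure_distr) auto
    also have "moment_map -` box a b =
        {z :: complex^'n. \<forall>i. z $ i \<in> {c. a $ i < pi * (cmod c)\<^sup>2 \<and> pi * (cmod c)\<^sup>2 < b $ i}}"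
      by (auto simp: bx moment_map_def)
    also have "emeasure lborel \<dots> = (\<Prod>i\<in>UNIV. emeasure lborel {c::complex. a $ i < pi * (cmod c)\<^sup>2 \<and> pi * (cmod c)\<^sup>2 < b $ i})"
    proof (rule emeasure_lborel_vec)
      show "{c::complex. a $ i < pi * (cmod c)\<^sup>2 \<and> pi * (cmod c)\<^sup>2 < b $ i} \<in> sets borel" for i
        by measurable
    qed
    also have "\<dots> = (\<Prod>i\<in>UNIV. emeasure lborel ({0..} \<inter> {a $ i<..<b $ i}))"
      by (simp only: emeasure_complex_annulus)
    also have "\<dots> = emeasure lborel {x :: real^'n. \<forall>i. x $ i \<in> {0..} \<inter> {a $ i<..<b $ i}}"
      by (rule emeasure_lborel_vec[symmetric]) auto
    also have "{x :: real^'n. \<forall>i. x $ i \<in> {0..} \<inter> {a $ i<..<b $ i}} = orthant \<inter> box a b"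
      by (auto simp: bx orthant_def)
    also have "emeasure lborel \<dots> = emeasure ?M (box a b)"
      by (subst emeasure_density) (auto simp: indicator_inter_arith[symmetric])
    finally show ?thesis .
  qed
  show "emeasure ?N X = emeasure ?M X" if "X \<in> ?E" for X using that eq by auto
  show "Int_stable ?E" by (auto simp: Int_stable_def box_Int_box)
  show "?E \<subseteq> Pow UNIV" "sets ?N = sigma_sets UNIV ?E" "sets ?M = sigma_sets UNIV ?E"
    by (simp_all add: borel_eq_box)
  let ?A = "\<lambda>n::nat. box (- (real n *\<^sub>R One)) (real n *\<^sub>R One) :: (real^'n) set"
  show "range ?A \<subseteq> ?E" "(\<Union>i. ?A i) = UNIV"
    unfolding UN_box_eq_UNIV by auto
  show "emeasure ?N (?A n) \<noteq> \<infinity>" for n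
  proof -
    have "emeasure ?M (?A n) \<le> emeasure lborel (?A n)"
      by (subst emeasure_density) (auto intro!: nn_integral_mono simp: indicator_def simp flip: nn_integral_indicator)
    also have "\<dots> < \<infinity>" by auto
    finally show ?thesis unfolding eq by simp
  qed
qed

text \<open>Functions vanishing off the orthant absorb the indicator density of the pushed-forward
  measure.\<close>

lemma
  fixes F :: "real^'n \<Rightarrow> real"
  assumes F: "F \<in> borel_measurable borel" and zero: "\<And>x. x \<notin> orthant \<Longrightarrow> F x = 0"
  shows integral_moment_map: "(LINT z|lborel. F (moment_map z)) = (LINT x|lborel. F x)"
    and integrable_moment_map: "integrable lborel (\<lambda>z :: complex^'n. F (moment_map z)) \<longleftrightarrow> integrable lborel F"
proof -
  have mm [measurable]: "(moment_map :: complex^'n \<Rightarrow> real^'n) \<in> borel_measurable lborel"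
    by (simp, intro borel_measurable_continuous_onI continuous_on_moment_map)
  have [measurable]: "(orthant :: (real^'n) set) \<in> sets borel"
    using closed_orthant by (rule borel_closed)
  have eq: "indicator orthant x *\<^sub>R F x = F x" for x using zero[of x] by (auto simp: indicator_def)
  have dens: "density lborel (\<lambda>x. indicator orthant x) =
      density lborel (\<lambda>x :: real^'n. ennreal (indicator orthant x))" by (simp add: ennreal_indicator)
  have "(LINT z|lborel. F (moment_map z)) = (LINT x|density lborel (\<lambda>x. indicator orthant x). F x)"
    unfolding distr_moment_map[symmetric] by (rule integral_distr[symmetric, OF mm F])
  also have "\<dots> = (LINT x|lborel. indicator orthant x *\<^sub>R F x)"
    unfolding dens by (rule integral_density) (use F in auto)
  finally show "(LINT z|lborel. F (moment_map z)) = (LINT x|lborel. F x)" by (simp only: eq)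
  have "integrable lborel (\<lambda>z :: complex^'n. F (moment_map z)) \<longleftrightarrow>
      integrable (density lborel (\<lambda>x. indicator orthant x)) F"
    unfolding distr_moment_map[symmetric] by (rule integrable_distr_eq[symmetric, OF mm F])
  also have "\<dots> \<longleftrightarrow> integrable lborel (\<lambda>x. indicator orthant x *\<^sub>R F x)"
    unfolding dens by (rule integrable_density) (use F in auto)
  finally show "integrable lborel (\<lambda>z :: complex^'n. F (moment_map z)) \<longleftrightarrow> integrable lborel F"
    by (simp only: eq)
qed

section \<open>Lifts and homogeneity\<close>

lemma has_vector_derivative_zero_constant_real:
  fixes f :: "real \<Rightarrow> 'a::real_normed_vector"
  assumes "\<And>s. (f has_vector_derivative 0) (at s)"
  shows "f s = f t"
proof -
  obtain c where "\<And>s. f s = c"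
    using has_derivative_zero_constant[of UNIV f] assms by (auto simp: has_vector_derivative_def)
  then show ?thesis by simp
qed

text \<open>The quotient of \<open>\<phi>\<close> by \<open>s ^ k\<close> has derivative 0. It
  serves with \<open>k = 1\<close> for the gauge and with \<open>k = 2\<close> for Hamiltonians,
  along rays.\<close>

lemma euler_ode_power:
  fixes \<phi> :: "real \<Rightarrow> real"
  assumes "\<And>s. s > 0 \<Longrightarrow> (\<phi> has_real_derivative real k * \<phi> s / s) (at s)" "s > 0"
  shows "\<phi> s = s ^ k * \<phi> 1"
proof -
  have d: "((\<lambda>s. \<phi> s / s ^ k) has_real_derivative 0) (at s within {0<..})" if s: "s > 0" for s
  proof -
    have "((\<lambda>s. \<phi> s / s ^ k) has_real_derivative
        (real k * \<phi> s / s * s ^ k - \<phi> s * (real k * s ^ (k - 1))) / (s ^ k * s ^ k)) (at s)"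
      using DERIV_divide[OF assms(1)[OF s] DERIV_pow[of k s]] s by simp
    moreover have "real k * \<phi> s / s * s ^ k - \<phi> s * (real k * s ^ (k - 1)) = 0"
      using s by (cases k) (simp_all add: field_simps)
    ultimately show ?thesis by (simp add: has_field_derivative_at_within)
  qed
  have "\<exists>c. \<forall>s\<in>{0<..}. \<phi> s / s ^ k = c"
    by (rule has_field_derivative_zero_constant) (use d in auto)
  then obtain c where c: "\<And>s. s > 0 \<Longrightarrow> \<phi> s / s ^ k = c" by auto
  have "\<phi> 1 = c" using c[of 1] by simp
  then show ?thesis using c[OF assms(2)] assms(2) by (simp add: field_simps)
qed

lemma continuous_integer_valued_constant:
  fixes d :: "real \<Rightarrow> real"
  assumes "continuous_on UNIV d" "\<And>t. d t \<in> \<int>"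
  shows "d t = d 0"
proof -
  have "d constant_on UNIV"
  proof (rule continuous_discrete_range_constant[OF connected_UNIV assms(1)])
    fix t
    show "\<exists>e>0. \<forall>y. y \<in> UNIV \<and> d y \<noteq> d t \<longrightarrow> e \<le> norm (d y - d t)"
      using assms(2) Ints_nonzero_abs_ge1[of "d y - d t" for y]
      by (intro exI[of _ 1]) (auto simp: Ints_diff)
  qed
  then show ?thesis by (auto simp: constant_on_def)
qed

text \<open>The difference of two lifts is continuous and integer-valued, hence constant. This makes
  the \<open>THE\<close> in \<open>rotation_lift\<close> well defined.\<close>

lemma continuous_lift_unique:
  fixes u v :: "real \<Rightarrow> real"
  assumes "continuous_on UNIV u" "continuous_on UNIV v" "u 0 = v 0"
    and "\<And>t. exp (2 * of_real pi * \<i> * of_real (u t)) = exp (2 * of_real pi * \<i> * of_real (v t))"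
  shows "u = v"
proof
  fix t
  have "u t - v t \<in> \<int>" for t
  proof -
    have "exp (2 * of_real pi * \<i> * of_real (u t - v t)) = 1"
      using assms(4)[of t] by (simp add: ring_distribs exp_diff)
    then obtain n :: int where "2 * pi * (u t - v t) = of_int (2 * n) * pi"
      by (auto simp: exp_eq_1)
    then have "u t - v t = of_int n" by simp
    then show ?thesis by (metis Ints_of_int)
  qed
  moreover have "continuous_on UNIV (\<lambda>t. u t - v t)" using assms by (intro continuous_intros)
  ultimately have "u t - v t = u 0 - v 0"
    using continuous_integer_valued_constant[of "\<lambda>t. u t - v t" t] by blast
  then show "u t = v t" using assms(3) by simp
qed

section \<open>Scaling, range and derivative of the moment map\<close>

lemma moment_map_nth: "moment_map z $ i = pi * (cmod (z $ i))\<^sup>2"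
  by (simp add: moment_map_def)

lemma moment_map_in_orthant: "moment_map z \<in> orthant"
  by (simp add: orthant_def moment_map_nth)

lemma moment_map_eq_0_iff [simp]: "moment_map z = 0 \<longleftrightarrow> z = 0"
  by (simp add: vec_eq_iff moment_map_nth)

lemma moment_map_scaleR: "moment_map (s *\<^sub>R z) = s\<^sup>2 *\<^sub>R moment_map z"
  by (simp add: vec_eq_iff moment_map_nth power_mult_distrib)

lemma moment_map_image: "moment_map ` (UNIV :: (complex^'n) set) = orthant"
proof -
  have "x = moment_map (\<chi> i. complex_of_real (sqrt (x $ i / pi)))" if "x \<in> orthant" for x :: "real^'n"
    using that by (simp add: orthant_def vec_eq_iff moment_map_nth)
  then show ?thesis using moment_map_in_orthant by blast
qed

lemma has_derivative_moment_map:
  fixes z :: "complex^'n"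
  shows "(moment_map has_derivative (\<lambda>v. \<chi> i. 2 * pi * (z $ i \<bullet> v $ i))) (at z within S)"
proof (rule has_derivative_vecI)
  fix i
  have "((\<lambda>z :: complex^'n. pi * (z $ i \<bullet> z $ i)) has_derivative
      (\<lambda>v. pi * (z $ i \<bullet> v $ i + v $ i \<bullet> z $ i))) (at z within S)"
    by (intro has_derivative_mult_right has_derivative_inner has_derivative_vec_nth has_derivative_ident)
  moreover have "pi * (z $ i \<bullet> v $ i + v $ i \<bullet> z $ i) = 2 * pi * (z $ i \<bullet> v $ i)" for v
    by (simp add: inner_commute[of "v $ i"])
  ultimately show "((\<lambda>z :: complex^'n. moment_map z $ i) has_derivative
      (\<lambda>v. (\<chi> i. 2 * pi * (z $ i \<bullet> v $ i)) $ i)) (at z within S)"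
    by (simp add: moment_map_nth power2_norm_eq_inner)
qed

lemma Ck_on_moment_map_nth:
  fixes S :: "(complex^'n) set"
  assumes S: "open S" shows "Ck_on k S (\<lambda>z. moment_map z $ i)"
proof -
  have lin: "bounded_linear (\<lambda>z :: complex^'n. Re (z $ i))" "bounded_linear (\<lambda>z :: complex^'n. Im (z $ i))"
    by (intro bounded_linear_compose[OF bounded_linear_Re] bounded_linear_compose[OF bounded_linear_Im]
        bounded_linear_vec_nth)+
  have "Ck_on k S (\<lambda>z :: complex^'n. pi * (Re (z $ i) * Re (z $ i) + Im (z $ i) * Im (z $ i)))"
    using S lin by (intro Ck_on_mult Ck_on_add Ck_on_const Ck_on_bounded_linear)
  moreover have "moment_map z $ i = pi * (Re (z $ i) * Re (z $ i) + Im (z $ i) * Im (z $ i))"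
    for z :: "complex^'n"
    unfolding moment_map_nth cmod_power2 by (simp add: power2_eq_square)
  ultimately show ?thesis by simp
qed

section \<open>The canonical Hamiltonian of a toric domain\<close>

lemma moment_map_0 [simp]: "moment_map 0 = 0"
  by simp

text \<open>Two functions are carried along: derivatives are taken of \<open>g\<close>, which lives
  on an open set, while values and Euler's identity are those of \<open>f\<close> on the
  orthant.\<close>

locale toric_hamiltonian =
  fixes \<Omega> :: "(real^'n) set" and f g :: "real^'n \<Rightarrow> real" and U :: "(real^'n) set"
  assumes star_shaped: "star_shaped_domain (toric_domain \<Omega>)"
    and open_U: "open U" and U: "orthant - {0} \<subseteq> U" and smooth: "smooth_on U g"
    and g_eq: "\<And>x. x \<in> orthant \<Longrightarrow> x \<noteq> 0 \<Longrightarrow> g x = f x"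
    and nonneg: "\<And>x. x \<in> orthant \<Longrightarrow> 0 \<le> f x"
    and \<Omega>_eq: "\<Omega> = {x \<in> orthant. f x \<le> 1}"
    and euler: "\<And>x. x \<in> orthant \<Longrightarrow> (\<Sum>i\<in>UNIV. x $ i * partial_deriv i f x) = f x"
begin

definition dg :: "'n \<Rightarrow> real^'n \<Rightarrow> real" where
  "dg i x = frechet_derivative g (at x) (axis i 1)"

definition H :: "complex^'n \<Rightarrow> real" where
  "H z = f (moment_map z)"

lemma in_U: "x \<in> orthant \<Longrightarrow> x \<noteq> 0 \<Longrightarrow> x \<in> U"
  using U by blast

lemma moment_map_in_U: "z \<noteq> 0 \<Longrightarrow> moment_map z \<in> U"
  by (simp add: in_U moment_map_in_orthant)

lemma Ck_g: "Ck_on k U g"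
  using smooth by (simp add: smooth_on_def)

lemma Ck_dg: "Ck_on k U (dg i)"
  using Ck_g[of "Suc k"] by (simp add: dg_def[abs_def])

lemma has_derivative_g: "x \<in> U \<Longrightarrow> (g has_derivative (\<lambda>v. \<Sum>i\<in>UNIV. v $ i * dg i x)) (at x)"
proof -
  assume x: "x \<in> U"
  note d = Ck_on_SucD_has_derivative[OF Ck_g x]
  have "frechet_derivative g (at x) v = (\<Sum>i\<in>UNIV. v $ i * dg i x)" for v
    using linear_eq_sum_axis[OF has_derivative_linear[OF d], of v] by (simp add: dg_def)
  then have "frechet_derivative g (at x) = (\<lambda>v. \<Sum>i\<in>UNIV. v $ i * dg i x)" by blast
  with d show ?thesis by simp
qed

lemma has_vector_derivative_f:
  assumes x: "x \<in> orthant" "x \<noteq> 0"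
  shows "((\<lambda>t. f (x + t *\<^sub>R axis i 1)) has_vector_derivative dg i x) (at 0 within {t. 0 \<le> x $ i + t})"
proof -
  let ?S = "{t. 0 \<le> x $ i + t}"
  have "((\<lambda>t. x + t *\<^sub>R axis i 1) has_derivative (\<lambda>t. t *\<^sub>R axis i 1)) (at 0)"
    by (auto intro!: derivative_eq_intros)
  moreover have "(g has_derivative (\<lambda>v. \<Sum>i\<in>UNIV. v $ i * dg i x)) (at (x + 0 *\<^sub>R axis i 1))"
    using has_derivative_g[OF in_U[OF x]] by simp
  ultimately have "((\<lambda>t. g (x + t *\<^sub>R axis i 1)) has_derivative
      (\<lambda>t. \<Sum>j\<in>UNIV. (t *\<^sub>R axis i 1 :: real^'n) $ j * dg j x)) (at 0)"
    by (rule has_derivative_compose)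
  moreover have "(\<Sum>j\<in>UNIV. (t *\<^sub>R axis i 1 :: real^'n) $ j * dg j x) = t * dg i x" for t
    by (simp add: axis_def if_distrib[where f = "\<lambda>y. y * _"] if_distrib[where f = "\<lambda>y. _ * y"] cong: if_cong)
  ultimately have "((\<lambda>t. g (x + t *\<^sub>R axis i 1)) has_vector_derivative dg i x) (at 0)"
    by (simp add: has_vector_derivative_def)
  then have "((\<lambda>t. g (x + t *\<^sub>R axis i 1)) has_vector_derivative dg i x) (at 0 within ?S)"
    by (rule has_vector_derivative_at_within)
  then show ?thesis
  proof (rule has_vector_derivative_transform_within)
    \<comment> \<open>A displacement along an axis shorter than \<open>norm x\<close> cannot reach
      0, so \<open>f\<close> and \<open>g\<close> agree at the displaced point.\<close>
    show "0 < norm x" using x by simp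
    show "0 \<in> ?S" using x by (simp add: orthant_def)
    fix t assume t: "t \<in> ?S" "dist t 0 < norm x"
    have "x + t *\<^sub>R axis i 1 \<in> orthant"
      using t x by (auto simp: orthant_def axis_def)
    moreover have "x + t *\<^sub>R axis i 1 \<noteq> 0"
    proof
      assume "x + t *\<^sub>R axis i 1 = 0"
      then have "x = - (t *\<^sub>R axis i 1)" by (simp add: eq_neg_iff_add_eq_0)
      then have "norm x = \<bar>t\<bar>" by simp
      then show False using t(2) by simp
    qed
    ultimately show "g (x + t *\<^sub>R axis i 1) = f (x + t *\<^sub>R axis i 1)" by (rule g_eq)
  qed
qed

lemma partial_deriv_f:
  assumes x: "x \<in> orthant" "x \<noteq> 0" shows "partial_deriv i f x = dg i x"
proof -
  let ?S = "{t. 0 \<le> x $ i + t}"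
  have "at 0 within ?S \<noteq> bot"
  proof -
    have "at_right 0 \<le> at 0 within ?S"
    proof (rule at_le)
      have "0 \<le> x $ i" using x(1) by (simp add: orthant_def)
      then show "{0<..} \<subseteq> ?S" by auto
    qed
    then show ?thesis by (metis bot.extremum_uniqueI trivial_limit_at_right_real)
  qed
  then show ?thesis
    unfolding partial_deriv_def
    by (rule vector_derivative_within[OF _ has_vector_derivative_f[OF x]])
qed

lemma orthant_scaleR: "x \<in> orthant \<Longrightarrow> 0 \<le> s \<Longrightarrow> s *\<^sub>R x \<in> orthant"
  by (simp add: orthant_def)

text \<open>Along a ray Euler's identity becomes the linear equation of
  \<open>euler_ode_power\<close> with \<open>k = 1\<close>.\<close>

lemma f_scaleR:
  assumes x: "x \<in> orthant" "x \<noteq> 0" and s: "s > 0" shows "f (s *\<^sub>R x) = s * f x"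
proof -
  have "((\<lambda>s. g (s *\<^sub>R x)) has_real_derivative real 1 * g (s *\<^sub>R x) / s) (at s)" if s: "s > 0" for s
  proof -
    have sx: "s *\<^sub>R x \<in> orthant" "s *\<^sub>R x \<noteq> 0"
      using orthant_scaleR[OF x(1), of s] x s by simp_all
    have "((\<lambda>s. s *\<^sub>R x) has_derivative (\<lambda>t. t *\<^sub>R x)) (at s)"
      by (auto intro!: derivative_eq_intros)
    from has_derivative_compose[OF this has_derivative_g[OF in_U[OF sx]]]
    have "((\<lambda>s. g (s *\<^sub>R x)) has_derivative (\<lambda>t. \<Sum>i\<in>UNIV. (t *\<^sub>R x) $ i * dg i (s *\<^sub>R x))) (at s)" .
    moreover have "(\<lambda>t. \<Sum>i\<in>UNIV. (t *\<^sub>R x) $ i * dg i (s *\<^sub>R x)) = (*) (real 1 * g (s *\<^sub>R x) / s)"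
    proof
      fix t
      have "g (s *\<^sub>R x) = (\<Sum>i\<in>UNIV. (s *\<^sub>R x) $ i * dg i (s *\<^sub>R x))"
        using euler[OF sx(1)] by (simp add: g_eq[OF sx] partial_deriv_f[OF sx])
      also have "\<dots> = s * (\<Sum>i\<in>UNIV. x $ i * dg i (s *\<^sub>R x))"
        by (simp add: sum_distrib_left mult.assoc)
      finally have "g (s *\<^sub>R x) / s = (\<Sum>i\<in>UNIV. x $ i * dg i (s *\<^sub>R x))" using s by simp
      then show "(\<Sum>i\<in>UNIV. (t *\<^sub>R x) $ i * dg i (s *\<^sub>R x)) = real 1 * g (s *\<^sub>R x) / s * t"
        by (simp add: sum_distrib_left mult_ac)
    qed
    ultimately show ?thesis by (simp only: has_field_derivative_def)
  qed
  from euler_ode_power[OF this s] have "g (s *\<^sub>R x) = s * g x" by simp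
  moreover have "s *\<^sub>R x \<in> orthant" using s by (intro orthant_scaleR x) simp
  ultimately show ?thesis using g_eq x s by simp
qed

text \<open>At the origin every summand of Euler's identity has a factor 0, whatever the value of
  \<open>partial_deriv\<close> there.\<close>

lemma f_0: "f 0 = 0"
  using euler[of 0] by (simp add: orthant_def)

lemma compact_domain: "compact (toric_domain \<Omega>)"
  using star_shaped by (simp add: star_shaped_domain_def)

lemma in_toric_domain_iff: "z \<in> toric_domain \<Omega> \<longleftrightarrow> H z \<le> 1"
  by (simp add: toric_domain_def H_def \<Omega>_eq moment_map_in_orthant)

lemma H_scaleR: "s > 0 \<Longrightarrow> H (s *\<^sub>R z) = s\<^sup>2 * H z"
  using f_scaleR[of "moment_map z" "s\<^sup>2"] f_0
  by (cases "z = 0") (simp_all add: H_def moment_map_scaleR moment_map_in_orthant)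

text \<open>If \<open>H\<close> vanished at \<open>z\<close>, the whole ray through \<open>z\<close> would lie in the bounded domain.\<close>

lemma H_pos: assumes "z \<noteq> 0" shows "H z > 0"
proof (rule ccontr)
  assume "\<not> H z > 0"
  then have "H z = 0" using nonneg[OF moment_map_in_orthant[of z]] by (simp add: H_def)
  then have in_X: "s *\<^sub>R z \<in> toric_domain \<Omega>" if "s > 0" for s
    using that by (simp add: in_toric_domain_iff H_scaleR)
  obtain B where B: "B > 0" "\<And>w. w \<in> toric_domain \<Omega> \<Longrightarrow> norm w \<le> B"
    using compact_imp_bounded[OF compact_domain] bounded_pos by blast
  have "norm ((2 * B / norm z) *\<^sub>R z) \<le> B"
    using assms B(1) by (intro B(2) in_X) simp
  then show False using assms B(1) by simp
qed

lemma f_pos: "x \<in> orthant \<Longrightarrow> x \<noteq> 0 \<Longrightarrow> f x > 0"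
proof -
  assume x: "x \<in> orthant" "x \<noteq> 0"
  then obtain z where "x = moment_map z" using moment_map_image by blast
  then show "f x > 0" using x(2) H_pos[of z] by (simp add: H_def)
qed

lemma H_0: "H 0 = 0"
  by (simp add: H_def f_0)

lemma H_eq_g: "z \<noteq> 0 \<Longrightarrow> H z = g (moment_map z)"
  by (simp add: H_def g_eq moment_map_in_orthant)

lemma smooth_H: "smooth_on (- {0}) H"
  unfolding smooth_on_def
proof
  fix k
  have "Ck_on k (- {0}) (\<lambda>z. g (moment_map z))"
    by (rule Ck_on_compose_vec[OF _ open_U])
      (use moment_map_in_U in \<open>auto intro!: Ck_on_moment_map_nth Ck_g\<close>)
  then show "Ck_on k (- {0}) H"
    by (subst Ck_on_cong[of _ _ "\<lambda>z. g (moment_map z)"]) (auto simp: H_eq_g)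
qed

text \<open>Stated for general \<open>h\<close> because it is applied to \<open>g\<close> for the
  gradient and to \<open>dg i\<close> for the Hessian.\<close>

lemma has_derivative_moment_compose:
  assumes "z \<noteq> 0" "Ck_on (Suc k) U h"
  shows "((\<lambda>z. h (moment_map z)) has_derivative
     (\<lambda>v. \<Sum>j\<in>UNIV. 2 * pi * (z $ j \<bullet> v $ j) * frechet_derivative h (at (moment_map z)) (axis j 1))) (at z)"
proof -
  note d = Ck_on_SucD_has_derivative[OF assms(2) moment_map_in_U[OF assms(1)]]
  show ?thesis
    using has_derivative_compose[OF has_derivative_moment_map d]
    by (subst (asm) linear_eq_sum_axis[OF has_derivative_linear[OF d]]) simp
qed

lemma has_derivative_H:
  assumes "z \<noteq> 0"
  shows "(H has_derivative (\<lambda>v. \<Sum>j\<in>UNIV. 2 * pi * (z $ j \<bullet> v $ j) * dg j (moment_map z))) (at z)"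
proof (rule has_derivative_transform_within_open)
  show "((\<lambda>z. g (moment_map z)) has_derivative
      (\<lambda>v. \<Sum>j\<in>UNIV. 2 * pi * (z $ j \<bullet> v $ j) * dg j (moment_map z))) (at z)"
    using has_derivative_moment_compose[OF assms Ck_g] by (simp add: dg_def)
  show "open (- {0 :: complex^'n})" by auto
qed (use assms in \<open>auto simp: H_eq_g\<close>)

lemma H_euler: "z \<noteq> 0 \<Longrightarrow> frechet_derivative H (at z) ((1/2) *\<^sub>R z) = H z"
proof -
  assume z: "z \<noteq> 0"
  have mz: "moment_map z \<in> orthant" "moment_map z \<noteq> 0"
    using z by (simp_all add: moment_map_in_orthant)
  have "frechet_derivative H (at z) ((1/2) *\<^sub>R z) =
      (\<Sum>j\<in>UNIV. moment_map z $ j * dg j (moment_map z))"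
    by (simp add: frechet_derivative_eqI[OF has_derivative_H[OF z]] moment_map_nth power2_norm_eq_inner)
  also have "\<dots> = H z" using euler[OF mz(1)] by (simp add: partial_deriv_f[OF mz] H_def)
  finally show ?thesis .
qed

text \<open>Where \<open>H\<close> is below 1, continuity gives interior points away from 0; where
  \<open>H\<close> equals 1, quadratic growth makes any radial push leave the domain.\<close>

lemma H_level: "{z. z \<noteq> 0 \<and> H z = 1} = frontier (toric_domain \<Omega>)"
proof -
  have cl: "closure (toric_domain \<Omega>) = toric_domain \<Omega>"
    using compact_domain by (simp add: compact_imp_closed)
  have zero: "0 \<in> interior (toric_domain \<Omega>)" using star_shaped by (simp add: star_shaped_domain_def)
  have cont: "continuous_on (- {0}) H"
    using smooth_H[unfolded smooth_on_def, rule_format, of 0] by simp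
  have int: "z \<in> interior (toric_domain \<Omega>)" if "z \<noteq> 0" "H z < 1" for z
  proof -
    have "open {w \<in> - {0}. H w < 1}"
    proof -
      have "open (H -` {..<1} \<inter> - {0})"
        by (rule continuous_open_preimage[OF cont, of "{..<1}", unfolded Int_commute[of "- {0}"]]) auto
      then show ?thesis by (simp add: vimage_def Int_def conj_commute)
    qed
    then show ?thesis
      using that by (intro interiorI[of "{w \<in> - {0}. H w < 1}"]) (auto simp: in_toric_domain_iff)
  qed
  have bd: "z \<notin> interior (toric_domain \<Omega>)" if "H z = 1" for z
  proof
    assume "z \<in> interior (toric_domain \<Omega>)"
    then obtain e where e: "e > 0" "ball z e \<subseteq> toric_domain \<Omega>" by (auto simp: mem_interior)
    \<comment> \<open>Moves \<open>z\<close> radially by at most \<open>e / 2\<close>; the 1 added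
      to \<open>norm z\<close> keeps the denominator positive without appeal to
      \<open>z \<noteq> 0\<close>.\<close>
    define t where "t = e / (2 * (norm z + 1))"
    have t: "t > 0" using e by (simp add: t_def add_nonneg_pos)
    have "t * norm z \<le> t * (norm z + 1)" using t by simp
    also have "\<dots> = e / 2" by (simp add: t_def field_simps add_nonneg_eq_0_iff)
    finally have "dist z ((1 + t) *\<^sub>R z) < e"
      using e t by (simp add: dist_norm algebra_simps)
    then have "H ((1 + t) *\<^sub>R z) \<le> 1" using e(2) in_toric_domain_iff by auto
    then have "(1 + t)\<^sup>2 \<le> 1" using H_scaleR[of "1 + t" z] t that by simp
    moreover have "(1 + t)\<^sup>2 > 1" using t by (simp add: power2_eq_square algebra_simps add_pos_pos)
    ultimately show False by simp
  qed
  have "z \<noteq> 0 \<and> H z = 1 \<longleftrightarrow> z \<in> toric_domain \<Omega> - interior (toric_domain \<Omega>)" for z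
  proof
    assume "z \<noteq> 0 \<and> H z = 1"
    then show "z \<in> toric_domain \<Omega> - interior (toric_domain \<Omega>)"
      using bd[of z] by (simp add: in_toric_domain_iff)
  next
    assume z: "z \<in> toric_domain \<Omega> - interior (toric_domain \<Omega>)"
    then have "z \<noteq> 0" using zero by blast
    moreover have "\<not> H z < 1" using int[of z] z calculation by blast
    moreover have "H z \<le> 1" using z by (simp add: in_toric_domain_iff)
    ultimately show "z \<noteq> 0 \<and> H z = 1" by simp
  qed
  then show ?thesis by (simp add: frontier_def cl set_eq_iff)
qed

text \<open>The condition on a competitor \<open>K\<close> is Euler's identity for degree 2, since
  the Liouville field is half the radial one. A function of degree 2 is determined by its unit level
  as soon as every ray meets that level.\<close>

lemma canonical_hamiltonian_eq: "canonical_hamiltonian (toric_domain \<Omega>) = H"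
  unfolding canonical_hamiltonian_def
proof (rule the_equality)
  show "smooth_on (- {0}) H \<and> H 0 = 0 \<and>
     (\<forall>z. z \<noteq> 0 \<longrightarrow> H z > 0 \<and> frechet_derivative H (at z) ((1/2) *\<^sub>R z) = H z) \<and>
     {z. z \<noteq> 0 \<and> H z = 1} = frontier (toric_domain \<Omega>)"
    using smooth_H H_0 H_pos H_euler H_level by blast
next
  fix K :: "complex^'n \<Rightarrow> real"
  assume K: "smooth_on (- {0}) K \<and> K 0 = 0 \<and>
     (\<forall>z. z \<noteq> 0 \<longrightarrow> K z > 0 \<and> frechet_derivative K (at z) ((1/2) *\<^sub>R z) = K z) \<and>
     {z. z \<noteq> 0 \<and> K z = 1} = frontier (toric_domain \<Omega>)"
  have Ck: "Ck_on (Suc 0) (- {0}) K" using K unfolding smooth_on_def by blast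
  have K_scaleR: "K (s *\<^sub>R z) = s\<^sup>2 * K z" if z: "z \<noteq> 0" and "s > 0" for z s
  proof -
    have "((\<lambda>s. K (s *\<^sub>R z)) has_real_derivative real 2 * K (s *\<^sub>R z) / s) (at s)" if s: "s > 0" for s
    proof -
      have sz: "s *\<^sub>R z \<noteq> 0" using s z by simp
      note d = Ck_on_SucD_has_derivative[OF Ck, of "s *\<^sub>R z"]
      have lin: "linear (frechet_derivative K (at (s *\<^sub>R z)))" using d sz has_derivative_linear by auto
      have "((\<lambda>s. s *\<^sub>R z) has_derivative (\<lambda>t. t *\<^sub>R z)) (at s)"
        by (auto intro!: derivative_eq_intros)
      from has_derivative_compose[OF this d]
      have "((\<lambda>s. K (s *\<^sub>R z)) has_derivative (\<lambda>t. frechet_derivative K (at (s *\<^sub>R z)) (t *\<^sub>R z))) (at s)"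
        using sz by simp
      moreover have "(\<lambda>t. frechet_derivative K (at (s *\<^sub>R z)) (t *\<^sub>R z)) = (*) (real 2 * K (s *\<^sub>R z) / s)"
      proof
        fix t
        have "t *\<^sub>R z = (2 * t / s) *\<^sub>R ((1/2) *\<^sub>R (s *\<^sub>R z))" using s by simp
        then have "frechet_derivative K (at (s *\<^sub>R z)) (t *\<^sub>R z) =
            (2 * t / s) * frechet_derivative K (at (s *\<^sub>R z)) ((1/2) *\<^sub>R (s *\<^sub>R z))"
          by (simp only: linear_scale[OF lin] real_scaleR_def)
        also have "frechet_derivative K (at (s *\<^sub>R z)) ((1/2) *\<^sub>R (s *\<^sub>R z)) = K (s *\<^sub>R z)"
          using K sz by blast
        finally show "frechet_derivative K (at (s *\<^sub>R z)) (t *\<^sub>R z) = real 2 * K (s *\<^sub>R z) / s * t" by simp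
      qed
      ultimately show ?thesis by (simp only: has_field_derivative_def)
    qed
    from euler_ode_power[OF this \<open>s > 0\<close>] show ?thesis by simp
  qed
  show "K = H"
  proof
    fix z
    show "K z = H z"
    proof (cases "z = 0")
      case False
      \<comment> \<open>The scaling that brings \<open>z\<close> to the common unit level of
        \<open>H\<close> and \<open>K\<close>.\<close>
      define s where "s = 1 / sqrt (H z)"
      have s: "s > 0" "s\<^sup>2 * H z = 1" using H_pos[OF False] by (simp_all add: s_def power_divide)
      have "s *\<^sub>R z \<in> {z. z \<noteq> 0 \<and> H z = 1}" using False s by (simp add: H_scaleR)
      also have "\<dots> = {z. z \<noteq> 0 \<and> K z = 1}" using K H_level by simp
      finally have "s\<^sup>2 * K z = 1" using K_scaleR[OF False s(1)] by simp
      then have "s\<^sup>2 * K z = s\<^sup>2 * H z" using s(2) by simp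
      then show ?thesis using s(1) by simp
    qed (use K H_0 in simp)
  qed
qed

end

section \<open>The flow and its rotation\<close>

lemma prod_cis: "(\<Prod>i\<in>I. cis (a i)) = cis (\<Sum>i\<in>I. a i)"
  by (induction I rule: infinite_finite_induct) (auto simp: cis_mult)

text \<open>Rotating each coordinate by the phase of \<open>z $ i\<close> turns the Hessian term into \<open>\<i>\<close> times a real
  symmetric matrix acting on real parts, which is then diagonalised over the reals.\<close>

lemma phase_hessian_shear:
  fixes z :: "complex^'n" and h :: "'n \<Rightarrow> 'n \<Rightarrow> real"
  assumes h: "\<And>i j. h i j = h j i"
  obtains W :: "complex^'n^'n" and l :: "'n \<Rightarrow> real" where "unitary_matrix W"
    "\<And>t v. (\<chi> i. v $ i + \<i> * of_real (t * (\<Sum>j\<in>UNIV. h i j * (z $ j \<bullet> v $ j))) * z $ i) =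
       W *v (\<chi> k. shear (t * l k) ((adjoint_matrix W *v v) $ k))"
proof -
  \<comment> \<open>At a vanishing coordinate any phase would do; 1 keeps every \<open>e i\<close>
    of modulus one, so that \<open>W\<close> below is unitary.\<close>
  define e where "e i = (if z $ i = 0 then 1 else sgn (z $ i))" for i
  have ze: "z $ i = of_real (cmod (z $ i)) * e i" for i
    by (simp add: e_def sgn_eq)
  have "cmod (e i) = 1" for i by (simp add: e_def norm_sgn)
  then have ee: "cnj (e i) * e i = 1" for i
    using complex_norm_square[of "e i"] by (simp add: mult.commute)
  \<comment> \<open>After removal of the phases the Hessian term acts through the real matrix with
    entries \<open>cmod (z $ i) * h i j * cmod (z $ j)\<close>, symmetric because \<open>h\<close>
    is. It does not involve \<open>t\<close>.\<close>
  define T where "T x = (\<chi> i. \<Sum>j\<in>UNIV. cmod (z $ i) * h i j * cmod (z $ j) * x $ j)" for x :: "real^'n"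
  have lin: "linear T"
    by (rule linearI) (simp_all add: T_def vec_eq_iff sum.distrib sum_distrib_left algebra_simps)
  have sym: "T x \<bullet> y = x \<bullet> T y" for x y
  proof -
    have "T x \<bullet> y = (\<Sum>i\<in>UNIV. \<Sum>j\<in>UNIV. cmod (z $ i) * h i j * cmod (z $ j) * x $ j * y $ i)"
      by (simp add: T_def inner_vec_def sum_distrib_right)
    also have "\<dots> = (\<Sum>j\<in>UNIV. \<Sum>i\<in>UNIV. cmod (z $ i) * h i j * cmod (z $ j) * x $ j * y $ i)"
      by (rule sum.swap)
    also have "\<dots> = (\<Sum>j\<in>UNIV. \<Sum>i\<in>UNIV. x $ j * (cmod (z $ j) * h j i * cmod (z $ i) * y $ i))"
      using h by (intro sum.cong refl) (simp add: mult_ac)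
    also have "\<dots> = x \<bullet> T y" by (simp add: T_def inner_vec_def sum_distrib_left)
    finally show ?thesis .
  qed
  obtain u :: "'n \<Rightarrow> real^'n" and l where on: "\<And>i j. u i \<bullet> u j = (if i = j then 1 else 0)"
    and eig: "\<And>i. T (u i) = l i *\<^sub>R u i" and expand: "\<And>x. x = (\<Sum>i\<in>UNIV. (u i \<bullet> x) *\<^sub>R u i)"
    using symmetric_orthonormal_eigenvectors[OF lin sym] by blast
  \<comment> \<open>Column \<open>k\<close> is the real eigenvector \<open>u k\<close> with the
    phases restored. As \<open>u k\<close> is real, the real part of the \<open>k\<close>-th
    coordinate in this basis depends only on the real parts collected in \<open>x\<close>
    below.\<close>
  define W :: "complex^'n^'n" where "W = (\<chi> i k. e i * of_real (u k $ i))"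
  have "(adjoint_matrix W ** W) $ k $ m = (if k = m then 1 else 0)" for k m
  proof -
    have "(adjoint_matrix W ** W) $ k $ m = (\<Sum>i\<in>UNIV. (cnj (e i) * e i) * of_real (u k $ i * u m $ i))"
      by (simp add: adjoint_matrix_def matrix_matrix_mult_def W_def mult_ac)
    also have "\<dots> = of_real (u k \<bullet> u m)" by (simp add: ee inner_vec_def)
    finally show ?thesis by (simp add: on)
  qed
  then have W: "unitary_matrix W" by (simp add: unitary_matrix_iff mat_def vec_eq_iff)
  have "(\<chi> i. v $ i + \<i> * of_real (t * (\<Sum>j\<in>UNIV. h i j * (z $ j \<bullet> v $ j))) * z $ i) =
       W *v (\<chi> k. shear (t * l k) ((adjoint_matrix W *v v) $ k))" for t v
  proof -
    define x :: "real^'n" where "x = (\<chi> j. e j \<bullet> v $ j)"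
    define w where "w = adjoint_matrix W *v v"
    \<comment> \<open>The part added to \<open>w\<close> by the shears; \<open>W\<close> must carry
      it to the Hessian term.\<close>
    define y :: "complex^'n" where "y = (\<chi> k. \<i> * of_real (t * l k * (u k \<bullet> x)))"
    have "Re (w $ k) = (\<Sum>i\<in>UNIV. Re (cnj (e i) * of_real (u k $ i) * v $ i))" for k
      by (simp add: w_def adjoint_matrix_def matrix_vector_mult_def W_def)
    also have "(\<Sum>i\<in>UNIV. Re (cnj (e i) * of_real (u k $ i) * v $ i)) = u k \<bullet> x" for k
      by (simp add: x_def inner_vec_def inner_complex_def algebra_simps)
    finally have Re_w: "Re (w $ k) = u k \<bullet> x" for k .
    have "(\<chi> k. shear (t * l k) (w $ k)) = w + y"
      by (simp add: vec_eq_iff shear_def y_def Re_w)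
    then have "W *v (\<chi> k. shear (t * l k) (w $ k)) = W *v w + W *v y"
      by (simp only: matrix_vector_right_distrib)
    also have "W *v w = v"
      by (simp add: w_def matrix_vector_mul_assoc unitary_matrix_right[OF W])
    also have "(W *v y) $ i = \<i> * of_real (t * (\<Sum>j\<in>UNIV. h i j * (z $ j \<bullet> v $ j))) * z $ i" for i
    proof -
      have "T x = (\<Sum>k\<in>UNIV. (u k \<bullet> x) *\<^sub>R (l k *\<^sub>R u k))"
        by (subst expand[of x]) (simp add: linear_sum[OF lin] linear_scale[OF lin] eig)
      then have Tx: "T x $ i = (\<Sum>k\<in>UNIV. l k * (u k \<bullet> x) * u k $ i)" by (simp add: mult_ac)
      have "(W *v y) $ i = (\<Sum>k\<in>UNIV. \<i> * of_real t * e i * of_real (l k * (u k \<bullet> x) * u k $ i))"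
        by (simp add: matrix_vector_mult_def W_def y_def mult_ac)
      also have "\<dots> = \<i> * of_real t * e i * of_real (T x $ i)"
        by (simp only: Tx of_real_sum sum_distrib_left)
      also have "T x $ i = (\<Sum>j\<in>UNIV. cmod (z $ i) * (h i j * (z $ j \<bullet> v $ j)))"
        unfolding T_def vec_lambda_beta x_def
      proof (intro sum.cong refl)
        fix j
        have "z $ j \<bullet> v $ j = (cmod (z $ j) *\<^sub>R e j) \<bullet> v $ j"
          using ze[of j] by (simp add: scaleR_conv_of_real)
        then show "cmod (z $ i) * h i j * cmod (z $ j) * (e j \<bullet> v $ j) = cmod (z $ i) * (h i j * (z $ j \<bullet> v $ j))"
          by simp
      qed
      also have "\<dots> = cmod (z $ i) * (\<Sum>j\<in>UNIV. h i j * (z $ j \<bullet> v $ j))"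
        by (simp only: sum_distrib_left)
      finally have "(W *v y) $ i =
          \<i> * of_real (t * (\<Sum>j\<in>UNIV. h i j * (z $ j \<bullet> v $ j))) * (of_real (cmod (z $ i)) * e i)"
        by (simp only: of_real_mult mult_ac)
      then show ?thesis using ze[of i] by simp
    qed
    ultimately show ?thesis by (simp add: vec_eq_iff w_def)
  qed
  then show thesis using that W by blast
qed

context toric_hamiltonian
begin

definition ang :: "'n \<Rightarrow> complex^'n \<Rightarrow> real" where
  "ang i z = 2 * pi * dg i (moment_map z)"

definition flow :: "real \<Rightarrow> complex^'n \<Rightarrow> complex^'n" where
  "flow t z = (\<chi> i. cis (t * ang i z) * z $ i)"

lemma gradient_H:
  assumes "z \<noteq> 0" shows "gradient H z = (\<chi> i. ang i z *\<^sub>R z $ i)"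
  unfolding gradient_def
proof (rule the_equality)
  let ?G = "\<chi> i. ang i z *\<^sub>R z $ i"
  have "(\<lambda>v. \<Sum>j\<in>UNIV. 2 * pi * (z $ j \<bullet> v $ j) * dg j (moment_map z)) = (\<lambda>v. v \<bullet> ?G)"
    by (rule ext) (simp add: inner_vec_def ang_def inner_commute mult_ac)
  then show G: "GDERIV H z :> ?G"
    using has_derivative_H[OF assms] by (simp add: gderiv_def)
  fix G assume "GDERIV H z :> G"
  then have "(\<lambda>v. v \<bullet> G) = (\<lambda>v. v \<bullet> ?G)"
    using G has_derivative_unique unfolding gderiv_def by blast
  then show "G = ?G" by (metis vector_eq_ldot)
qed

lemma moment_map_flow [simp]: "moment_map (flow t z) = moment_map z"
  by (simp add: vec_eq_iff moment_map_nth flow_def norm_mult)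

lemma flow_eq_0_iff [simp]: "flow t z = 0 \<longleftrightarrow> z = 0"
  using moment_map_flow[of t z] by (metis moment_map_eq_0_iff)

lemma ang_flow [simp]: "ang i (flow t z) = ang i z"
  by (simp add: ang_def)

lemma flow_solution:
  assumes "z \<noteq> 0"
  shows "((\<lambda>s. flow s z) has_vector_derivative \<i> *s gradient H (flow s z)) (at s)"
  unfolding has_vector_derivative_def
proof (rule has_derivative_vecI)
  fix i
  have "((\<lambda>s. cis (s * ang i z) * z $ i) has_derivative
      (\<lambda>r. (r * ang i z) *\<^sub>R (\<i> * cis (s * ang i z)) * z $ i)) (at s)"
    by (auto intro!: derivative_eq_intros)
  moreover have "(r * ang i z) *\<^sub>R (\<i> * cis (s * ang i z)) * z $ i =
      (r *\<^sub>R (\<i> *s gradient H (flow s z))) $ i" for r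
    using assms by (simp add: gradient_H) (simp add: flow_def scaleR_conv_of_real mult_ac)
  ultimately show "((\<lambda>s. flow s z $ i) has_derivative
      (\<lambda>r. (r *\<^sub>R (\<i> *s gradient H (flow s z))) $ i)) (at s)"
    by (simp add: flow_def)
qed

text \<open>Along any solution \<open>|\<gamma>\<^sub>i|\<^sup>2\<close> is constant, so that the angular speeds are constant and
  each coordinate solves a linear equation.\<close>

lemma solution_eq_flow:
  assumes \<gamma>0: "\<gamma> 0 = z" and nz: "\<And>s. \<gamma> s \<noteq> 0"
    and ode: "\<And>s. (\<gamma> has_vector_derivative \<i> *s gradient H (\<gamma> s)) (at s)"
  shows "\<gamma> t = flow t z"
proof -
  have d: "((\<lambda>s. \<gamma> s $ i) has_vector_derivative \<i> * (ang i (\<gamma> s) *\<^sub>R \<gamma> s $ i)) (at s)" for i s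
    using has_derivative_vec_nth[OF ode[of s, unfolded has_vector_derivative_def], of i]
    by (simp add: has_vector_derivative_def gradient_H[OF nz])
  have "((\<lambda>s. \<gamma> s $ i \<bullet> \<gamma> s $ i) has_vector_derivative 0) (at s)" for i s
  proof -
    have "c \<bullet> (\<i> * c) = 0" for c by (simp add: inner_complex_def)
    then show ?thesis
      using has_derivative_inner[OF d[of i s, unfolded has_vector_derivative_def] d[of i s, unfolded has_vector_derivative_def]]
      by (simp add: has_vector_derivative_def inner_commute)
  qed
  from has_vector_derivative_zero_constant_real[OF this]
  have "moment_map (\<gamma> s) = moment_map z" for s
    by (simp add: vec_eq_iff moment_map_nth power2_norm_eq_inner flip: \<gamma>0)
  then have ang: "ang i (\<gamma> s) = ang i z" for i s by (simp add: ang_def)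
  \<comment> \<open>Integrating factor: undoing the expected rotation leaves a constant.\<close>
  have "((\<lambda>s. cis (- s * ang i z) * \<gamma> s $ i) has_vector_derivative 0) (at s)" for i s
  proof -
    have c: "((\<lambda>s. cis (- s * ang i z)) has_vector_derivative - ang i z *\<^sub>R (\<i> * cis (- s * ang i z))) (at s)"
      unfolding has_vector_derivative_def by (auto intro!: derivative_eq_intros)
    have "cis (- s * ang i z) * (\<i> * (ang i (\<gamma> s) *\<^sub>R \<gamma> s $ i)) +
        (- ang i z *\<^sub>R (\<i> * cis (- s * ang i z))) * \<gamma> s $ i = 0"
      by (simp add: ang scaleR_conv_of_real)
    with has_vector_derivative_mult[OF c d[of i s]] show ?thesis by simp
  qed
  then have "cis (- t * ang i z) * \<gamma> t $ i = cis (- 0 * ang i z) * \<gamma> 0 $ i" for i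
    by (rule has_vector_derivative_zero_constant_real)
  then have "cis (- t * ang i z) * \<gamma> t $ i = z $ i" for i by (simp add: \<gamma>0)
  then have "cis (t * ang i z) * (cis (- t * ang i z) * \<gamma> t $ i) = cis (t * ang i z) * z $ i" for i by simp
  then show ?thesis by (simp add: vec_eq_iff flow_def mult.assoc[symmetric] cis_mult)
qed

lemma hamiltonian_flow_H:
  assumes "z \<noteq> 0" shows "hamiltonian_flow H t z = flow t z"
  unfolding hamiltonian_flow_def
proof (rule the_equality)
  have "flow 0 z = z" by (simp add: flow_def)
  then show "\<exists>\<gamma>. \<gamma> 0 = z \<and> (\<forall>s. \<gamma> s \<noteq> 0 \<and>
      (\<gamma> has_vector_derivative \<i> *s gradient H (\<gamma> s)) (at s)) \<and> \<gamma> t = flow t z"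
    using assms flow_solution by (intro exI[of _ "\<lambda>s. flow s z"]) simp
qed (use solution_eq_flow in blast)

section \<open>The linearised flow\<close>

definition hess :: "'n \<Rightarrow> 'n \<Rightarrow> real^'n \<Rightarrow> real" where
  "hess i j x = frechet_derivative (dg i) (at x) (axis j 1)"

lemma hess_symmetric: "x \<in> U \<Longrightarrow> hess i j x = hess j i x"
  using frechet_derivative_symmetric[OF open_U _ Ck_g[of 2], of x "axis i 1" "axis j 1"]
  by (simp add: hess_def dg_def[abs_def])

text \<open>The second term differentiates the phase. Its factor \<open>4 * pi\<^sup>2\<close> is
  one \<open>2 * pi\<close> from \<open>ang\<close> times one from the derivative of
  \<open>moment_map\<close>.\<close>

lemma has_derivative_flow:
  assumes "z \<noteq> 0"
  shows "(flow t has_derivative (\<lambda>v. \<chi> i. cis (t * ang i z) *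
    (v $ i + \<i> * of_real (t * (\<Sum>j\<in>UNIV. 4 * pi\<^sup>2 * hess i j (moment_map z) * (z $ j \<bullet> v $ j))) * z $ i))) (at z)"
proof (rule has_derivative_vecI)
  fix i
  let ?a' = "\<lambda>v. \<Sum>j\<in>UNIV. 4 * pi\<^sup>2 * hess i j (moment_map z) * (z $ j \<bullet> v $ j)"
  have "(ang i has_derivative (\<lambda>v. 2 * pi * (\<Sum>j\<in>UNIV. 2 * pi * (z $ j \<bullet> v $ j) * hess i j (moment_map z)))) (at z)"
    unfolding ang_def[abs_def] hess_def
    by (rule has_derivative_mult_right[OF has_derivative_moment_compose[OF assms Ck_dg]])
  moreover have "2 * pi * (\<Sum>j\<in>UNIV. 2 * pi * (z $ j \<bullet> v $ j) * hess i j (moment_map z)) = ?a' v" for v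
    by (simp add: sum_distrib_left power2_eq_square mult_ac)
  ultimately have "(ang i has_derivative ?a') (at z)" by simp
  from has_derivative_mult[OF has_derivative_cis[OF has_derivative_mult_right[OF this]]
      has_derivative_vec_nth[OF has_derivative_ident]]
  have "((\<lambda>w. cis (t * ang i w) * w $ i) has_derivative
      (\<lambda>v. cis (t * ang i z) * v $ i + ((t * ?a' v) *\<^sub>R (\<i> * cis (t * ang i z))) * z $ i)) (at z)" .
  moreover have "cis (t * ang i z) * v $ i + ((t * ?a' v) *\<^sub>R (\<i> * cis (t * ang i z))) * z $ i =
      cis (t * ang i z) * (v $ i + \<i> * of_real (t * ?a' v) * z $ i)" for v
    by (simp only: scaleR_conv_of_real ring_distribs mult_ac)
  ultimately show "((\<lambda>w. flow t w $ i) has_derivative (\<lambda>v. (\<chi> i. cis (t * ang i z) *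
    (v $ i + \<i> * of_real (t * (\<Sum>j\<in>UNIV. 4 * pi\<^sup>2 * hess i j (moment_map z) * (z $ j \<bullet> v $ j))) * z $ i)) $ i)) (at z)"
    by (simp add: flow_def)
qed

text \<open>The numbers \<open>l\<close> are fixed before \<open>t\<close>: time only rescales the
  shear parameters. The argument of \<open>cis\<close> is therefore visibly continuous in
  \<open>t\<close>.\<close>

lemma det_unitary_part_flow:
  assumes z: "z \<noteq> 0"
  obtains l :: "'n \<Rightarrow> real" where
    "\<And>t. det (unitary_part (frechet_derivative (hamiltonian_flow H t) (at z))) =
       cis (t * (\<Sum>i\<in>UNIV. ang i z) + (\<Sum>k\<in>UNIV. arctan (t * l k / 2)))"
proof -
  let ?h = "\<lambda>i j. 4 * pi\<^sup>2 * hess i j (moment_map z)"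
  have sym: "?h i j = ?h j i" for i j using hess_symmetric[OF moment_map_in_U[OF z], of i j] by simp
  obtain W :: "complex^'n^'n" and l :: "'n \<Rightarrow> real" where W: "unitary_matrix W"
    and shear: "\<And>t v. (\<chi> i. v $ i + \<i> * of_real (t * (\<Sum>j\<in>UNIV. ?h i j * (z $ j \<bullet> v $ j))) * z $ i) =
       W *v (\<chi> k. shear (t * l k) ((adjoint_matrix W *v v) $ k))"
    by (rule phase_hessian_shear[of ?h z, OF sym]) (rule that)
  have "det (unitary_part (frechet_derivative (hamiltonian_flow H t) (at z))) =
       cis (t * (\<Sum>i\<in>UNIV. ang i z) + (\<Sum>k\<in>UNIV. arctan (t * l k / 2)))" for t
  proof -
    define D :: "complex^'n^'n" where "D = (\<chi> i j. if i = j then cis (t * ang i z) else 0)"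
    have D: "unitary_matrix D"
      by (simp add: unitary_matrix_iff D_def adjoint_matrix_def matrix_matrix_mult_def vec_eq_iff mat_def
          if_distrib[where f = "\<lambda>x. x * _"] if_distrib[where f = cnj] cis_cnj cis_mult cong: if_cong)
    have detD: "det D = cis (t * (\<Sum>i\<in>UNIV. ang i z))"
      by (subst det_diagonal) (simp_all add: D_def prod_cis sum_distrib_left)
    have Dv: "D *v x = (\<chi> i. cis (t * ang i z) * x $ i)" for x
      by (simp add: D_def matrix_vector_mult_def vec_eq_iff if_distrib[where f = "\<lambda>x. x * _"] cong: if_cong)
    have flow: "frechet_derivative (hamiltonian_flow H t) (at z) = frechet_derivative (flow t) (at z)"
      using z by (intro frechet_derivative_cong_open[of "- {0}"]) (auto simp: hamiltonian_flow_H)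
    have "frechet_derivative (hamiltonian_flow H t) (at z) v =
        D *v (W *v (\<chi> k. shear (t * l k) ((adjoint_matrix W *v v) $ k)))" for v
      unfolding flow frechet_derivative_eqI[OF has_derivative_flow[OF z]] shear[symmetric] Dv by simp
    then show ?thesis
      using det_unitary_part_shear[OF D W] by (simp add: detD prod_cis cis_mult)
  qed
  then show thesis by (rule that)
qed

text \<open>The closed-form argument divided by \<open>2 * pi\<close> is the lift: a linear term
  plus a bounded one. The limit thus exists at every nonzero point.\<close>

lemma has_ruelle_density_toric:
  assumes z: "z \<noteq> 0"
  shows "has_ruelle_density (toric_domain \<Omega>) z (\<Sum>i\<in>UNIV. dg i (moment_map z))"
proof -
  obtain l :: "'n \<Rightarrow> real" where l:
    "\<And>t. det (unitary_part (frechet_derivative (hamiltonian_flow H t) (at z))) =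
       cis (t * (\<Sum>i\<in>UNIV. ang i z) + (\<Sum>k\<in>UNIV. arctan (t * l k / 2)))"
    using det_unitary_part_flow[OF z] by blast
  define r where "r = (\<Sum>i\<in>UNIV. dg i (moment_map z))"
  \<comment> \<open>The bounded part of the lift, in full turns; it vanishes at \<open>t = 0\<close>
    because \<open>arctan 0 = 0\<close>.\<close>
  define b where "b t = (\<Sum>k\<in>UNIV. arctan (t * l k / 2)) / (2 * pi)" for t
  define u where "u t = t * r + b t" for t
  have exp_cis: "exp (2 * of_real pi * \<i> * of_real x) = cis (2 * pi * x)" for x
    by (simp add: cis_conv_exp mult_ac)
  have "t * (\<Sum>i\<in>UNIV. ang i z) + (\<Sum>k\<in>UNIV. arctan (t * l k / 2)) = 2 * pi * u t" for t
  proof -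
    have "(\<Sum>k\<in>UNIV. arctan (t * l k / 2)) = 2 * pi * b t" by (simp add: b_def)
    moreover have "(\<Sum>i\<in>UNIV. ang i z) = 2 * pi * r" by (simp add: ang_def r_def sum_distrib_left)
    ultimately show ?thesis by (simp add: u_def algebra_simps)
  qed
  then have det: "det (unitary_part (frechet_derivative (hamiltonian_flow H t) (at z))) =
      exp (2 * of_real pi * \<i> * of_real (u t))" for t
    by (simp only: l exp_cis)
  have cont: "continuous_on UNIV u"
    unfolding u_def b_def by (intro continuous_intros) auto
  have u0: "u 0 = 0" by (simp add: u_def b_def)
  have "rotation_lift (toric_domain \<Omega>) z = u"
    unfolding rotation_lift_def canonical_hamiltonian_eq
  proof (rule the_equality)
    show "continuous_on UNIV u \<and> u 0 = 0 \<and> (\<forall>t. exp (2 * of_real pi * \<i> * of_real (u t)) =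
        det (unitary_part (frechet_derivative (hamiltonian_flow H t) (at z))))"
      using cont u0 det by simp
    show "v = u" if "continuous_on UNIV v \<and> v 0 = 0 \<and> (\<forall>t. exp (2 * of_real pi * \<i> * of_real (v t)) =
        det (unitary_part (frechet_derivative (hamiltonian_flow H t) (at z))))" for v
      by (rule continuous_lift_unique) (use that cont u0 det in auto)
  qed
  moreover have "((\<lambda>T. u T / T) \<longlongrightarrow> r) at_top"
  proof -
    \<comment> \<open>Each arctangent is at most a quarter turn in absolute value, so
      \<open>B\<close> is a quarter of the dimension.\<close>
    define B where "B = (\<Sum>k\<in>(UNIV::'n set). pi / 2) / (2 * pi)"
    have "\<bar>b t\<bar> \<le> B" for t
    proof -
      have "\<bar>b t\<bar> = \<bar>\<Sum>k\<in>UNIV. arctan (t * l k / 2)\<bar> / (2 * pi)" by (simp add: b_def abs_divide)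
      also have "\<dots> \<le> B"
        unfolding B_def
      proof (intro divide_right_mono order_trans[OF sum_abs] sum_mono)
        show "\<bar>arctan (t * l k / 2)\<bar> \<le> pi / 2" for k
          using arctan_bounded[of "t * l k / 2"] by linarith
      qed simp
      finally show ?thesis .
    qed
    then have bound: "norm (b t / t) \<le> B / t" if "t > 0" for t
      using that by (simp add: divide_right_mono)
    have "((\<lambda>t. B / t) \<longlongrightarrow> 0) at_top"
      by (intro tendsto_divide_0[OF tendsto_const] filterlim_at_top_imp_at_infinity filterlim_ident)
    then have "((\<lambda>t. b t / t) \<longlongrightarrow> 0) at_top"
      by (rule Lim_null_comparison[rotated]) (use bound in \<open>auto intro: eventually_mono[OF eventually_gt_at_top[of 0]]\<close>)
    then have "((\<lambda>t. r + b t / t) \<longlongrightarrow> r + 0) at_top" by (intro tendsto_intros)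
    moreover have "\<forall>\<^sub>F t in at_top. r + b t / t = u t / t"
      using eventually_gt_at_top[of 0] by eventually_elim (simp add: u_def add_divide_distrib)
    ultimately show ?thesis by (simp add: tendsto_cong)
  qed
  ultimately show ?thesis by (simp add: has_ruelle_density_def r_def)
qed

lemma ruelle_density_toric:
  assumes "z \<noteq> 0"
  shows "ruelle_density (toric_domain \<Omega>) z = (\<Sum>i\<in>UNIV. dg i (moment_map z))"
  unfolding ruelle_density_def
proof (rule the_equality)
  show "has_ruelle_density (toric_domain \<Omega>) z (\<Sum>i\<in>UNIV. dg i (moment_map z))"
    using assms by (rule has_ruelle_density_toric)
  show "r = (\<Sum>i\<in>UNIV. dg i (moment_map z))" if "has_ruelle_density (toric_domain \<Omega>) z r" for r
    using that has_ruelle_density_toric[OF assms] tendsto_unique[OF trivial_limit_at_top_linorder]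
    unfolding has_ruelle_density_def by blast
qed

end

section \<open>The Ruelle invariant\<close>

context toric_hamiltonian
begin

lemma f_scaleR': "x \<in> orthant \<Longrightarrow> s > 0 \<Longrightarrow> f (s *\<^sub>R x) = s * f x"
  using f_scaleR[of x s] f_0 by (cases "x = 0") simp_all

text \<open>Differentiates \<open>f (s *\<^sub>R x + t *\<^sub>R axis i 1) = s * f (x + (t / s)
  *\<^sub>R axis i 1)\<close> at \<open>t = 0\<close>.\<close>

lemma dg_scaleR:
  assumes x: "x \<in> orthant" "x \<noteq> 0" and s: "s > 0" shows "dg i (s *\<^sub>R x) = dg i x"
proof -
  \<comment> \<open>Right-hand derivatives stay inside the orthant at faces as well, and
    \<open>{0..}\<close> is preserved by the rescaling of \<open>t\<close>.\<close>
  have right: "((\<lambda>t. f (y + t *\<^sub>R axis i 1)) has_vector_derivative dg i y) (at 0 within {0..})"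
    if y: "y \<in> orthant" "y \<noteq> 0" for y
  proof (rule has_vector_derivative_within_subset[OF has_vector_derivative_f[OF y]])
    have "0 \<le> y $ i" using y(1) by (simp add: orthant_def)
    then show "{0..} \<subseteq> {t. 0 \<le> y $ i + t}" by auto
  qed
  have sx: "s *\<^sub>R x \<in> orthant" "s *\<^sub>R x \<noteq> 0" using x s by (simp_all add: orthant_def)
  have img: "(\<lambda>t. t / s) ` {0..} = {0..}"
  proof (intro equalityI subsetI)
    fix t :: real assume "t \<in> {0..}"
    then show "t \<in> (\<lambda>t. t / s) ` {0..}" using s by (intro image_eqI[of _ _ "s * t"]) auto
  qed (use s in auto)
  have div: "((\<lambda>t. t / s) has_vector_derivative 1 / s) (at 0 within {0..})"
    using s by (auto intro!: derivative_eq_intros simp: has_real_derivative_iff_has_vector_derivative[symmetric])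
  have "((\<lambda>t. f (x + t *\<^sub>R axis i 1)) \<circ> (\<lambda>t. t / s) has_vector_derivative (1 / s) *\<^sub>R dg i x) (at 0 within {0..})"
    by (rule vector_diff_chain_within[OF div]) (use right[OF x] in \<open>simp add: img\<close>)
  then have "((\<lambda>t. s *\<^sub>R f (x + (t / s) *\<^sub>R axis i 1)) has_vector_derivative s *\<^sub>R ((1 / s) *\<^sub>R dg i x)) (at 0 within {0..})"
    unfolding o_def by (rule bounded_linear.has_vector_derivative[OF bounded_linear_scaleR_right])
  then have "((\<lambda>t. f (s *\<^sub>R x + t *\<^sub>R axis i 1)) has_vector_derivative s *\<^sub>R ((1 / s) *\<^sub>R dg i x)) (at 0 within {0..})"
  proof (rule has_vector_derivative_transform[rotated 2])
    fix t :: real assume "t \<in> {0..}"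
    then have "x + (t / s) *\<^sub>R axis i 1 \<in> orthant"
      using x s by (auto simp: orthant_def axis_def)
    from f_scaleR'[OF this s]
    show "f (s *\<^sub>R x + t *\<^sub>R axis i 1) = s *\<^sub>R f (x + (t / s) *\<^sub>R axis i 1)"
      using s by (simp add: scaleR_add_right)
  qed simp
  then have left: "((\<lambda>t. f (s *\<^sub>R x + t *\<^sub>R axis i 1)) has_vector_derivative dg i x) (at 0 within {0..})"
    using s by simp
  have "at (0::real) within {0..} \<noteq> bot" by (simp add: at_within_Ici_at_right)
  then show ?thesis using vector_derivative_within[OF _ left] vector_derivative_within[OF _ right[OF sx]] by simp
qed

lemma continuous_on_dg: "continuous_on (orthant - {0}) (dg i)"
  using Ck_dg[of 0 i] U by (auto intro: continuous_on_subset)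

text \<open>Homogeneity of degree 0 reduces the bound to the compact piece of the unit sphere in the
  orthant; in particular nothing blows up at the origin.\<close>

lemma dg_bounded: "\<exists>C. \<forall>x \<in> orthant - {0}. \<bar>dg i x\<bar> \<le> C"
proof -
  let ?K = "orthant \<inter> sphere 0 1 :: (real^'n) set"
  have "compact ?K" using closed_Int_compact[OF closed_orthant compact_sphere] .
  moreover have "continuous_on ?K (dg i)"
    by (rule continuous_on_subset[OF continuous_on_dg]) auto
  ultimately have "bounded (dg i ` ?K)" by (intro compact_imp_bounded compact_continuous_image)
  then obtain C where "\<forall>x\<in>?K. norm (dg i x) \<le> C" unfolding bounded_iff by blast
  then have C: "\<bar>dg i x\<bar> \<le> C" if "x \<in> ?K" for x using that by (simp only: real_norm_def)
  have "\<bar>dg i x\<bar> \<le> C" if x: "x \<in> orthant - {0}" for x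
  proof -
    have "(1 / norm x) *\<^sub>R x \<in> ?K" using x orthant_scaleR[of x "1 / norm x"] by simp
    from C[OF this] show ?thesis using x dg_scaleR[of x "1 / norm x" i] by simp
  qed
  then show ?thesis by blast
qed

text \<open>The image of the Hamiltonian shell under the moment map; \<open>region 0\<close> is
  \<open>\<Omega>\<close> without the origin.\<close>

definition region :: "real \<Rightarrow> (real^'n) set" where
  "region E = {x \<in> orthant - {0}. E \<le> f x \<and> f x \<le> 1}"

lemma borel_punctured_orthant [measurable]: "(orthant - {0} :: (real^'n) set) \<in> sets borel"
  using borel_closed[OF closed_orthant] by (intro sets.Diff) auto

lemma borel_region [measurable]: "region E \<in> sets borel"
proof -
  define f' where "f' x = indicator (orthant - {0}) x *\<^sub>R g x" for x
  have "continuous_on (orthant - {0}) g"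
    using Ck_g[of 0] U by (auto intro: continuous_on_subset)
  then have [measurable]: "f' \<in> borel_measurable borel"
    unfolding f'_def[abs_def] by (intro borel_measurable_continuous_on_indicator borel_punctured_orthant)
  have "region E = (orthant - {0}) \<inter> {x \<in> space borel. E \<le> f' x \<and> f' x \<le> 1}"
    by (auto simp: region_def f'_def g_eq)
  also have "\<dots> \<in> sets borel" by measurable
  finally show ?thesis .
qed

lemma borel_measurable_region_dg [measurable]:
  "(\<lambda>x. indicator (region E) x * dg i x) \<in> borel_measurable borel"
proof -
  have [measurable]: "(\<lambda>x. indicator (orthant - {0}) x *\<^sub>R dg i x) \<in> borel_measurable borel"
    by (intro borel_measurable_continuous_on_indicator borel_punctured_orthant continuous_on_dg)
  have "(\<lambda>x. indicator (region E) x * dg i x) =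
      (\<lambda>x. indicator (region E) x * (indicator (orthant - {0}) x *\<^sub>R dg i x))"
    by (auto simp: fun_eq_iff indicator_def region_def)
  also have "\<dots> \<in> borel_measurable borel" by measurable
  finally show ?thesis .
qed

lemma \<Omega>_eq_image: "\<Omega> = moment_map ` toric_domain \<Omega>"
proof -
  have "\<Omega> \<subseteq> range moment_map" by (auto simp: moment_map_image \<Omega>_eq)
  then show ?thesis unfolding toric_domain_def by blast
qed

lemma compact_\<Omega>: "compact \<Omega>"
  by (subst \<Omega>_eq_image) (intro compact_continuous_image continuous_on_moment_map compact_domain)

lemma integrable_\<Omega>: "integrable lborel (\<lambda>x. C * indicator \<Omega> x :: real)"
  using compact_\<Omega> emeasure_compact_finite[OF compact_\<Omega>]
  by (intro integrable_mult_right integrable_real_indicator) (auto intro: borel_compact)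

lemma dominated_region_dg: "\<exists>C. \<forall>E x. \<bar>indicator (region E) x * dg i x\<bar> \<le> C * indicator \<Omega> x"
proof -
  obtain C where C: "\<And>x. x \<in> orthant - {0} \<Longrightarrow> \<bar>dg i x\<bar> \<le> C" using dg_bounded by blast
  \<comment> \<open>The bound does not depend on \<open>E\<close>; the absolute value of
    \<open>C\<close> keeps the right side nonnegative outside \<open>region E\<close> too.\<close>
  have "\<bar>indicator (region E) x * dg i x\<bar> \<le> \<bar>C\<bar> * indicator \<Omega> x" for E x
    using C[of x] by (auto simp: indicator_def region_def \<Omega>_eq intro: order_trans[OF _ abs_ge_self])
  then show ?thesis by blast
qed

lemma integrable_region_dg: "integrable lborel (\<lambda>x. indicator (region E) x * dg i x)"
proof -
  obtain C where "\<And>E x. \<bar>indicator (region E) x * dg i x\<bar> \<le> C * indicator \<Omega> x"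
    using dominated_region_dg by blast
  then show ?thesis
    by (intro Bochner_Integration.integrable_bound[OF integrable_\<Omega>[of C]]) 
       (auto intro: order_trans[OF _ abs_ge_self])
qed

text \<open>Dominated convergence along sequences. At a fixed nonzero \<open>x\<close> of the
  orthant \<open>f x\<close> is positive, so the integrand is eventually constant once
  \<open>E k\<close> drops below \<open>f x\<close>.\<close>

lemma region_integral_tendsto:
  "((\<lambda>E. LINT x|lborel. indicator (region E) x * dg i x) \<longlongrightarrow>
     (LINT x|lborel. indicator (region 0) x * dg i x)) (at_right 0)"
  unfolding tendsto_at_iff_sequentially o_def
proof (intro allI impI)
  fix E :: "nat \<Rightarrow> real" assume E: "\<forall>k. E k \<in> {0<..} - {0}" "E \<longlonglongrightarrow> 0"
  obtain C where C: "\<And>E x. \<bar>indicator (region E) x * dg i x\<bar> \<le> C * indicator \<Omega> x"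
    using dominated_region_dg by blast
  show "(\<lambda>k. LINT x|lborel. indicator (region (E k)) x * dg i x) \<longlonglongrightarrow>
      (LINT x|lborel. indicator (region 0) x * dg i x)"
  proof (rule integral_dominated_convergence[where w = "\<lambda>x. C * indicator \<Omega> x"])
    show "AE x in lborel. (\<lambda>k. indicator (region (E k)) x * dg i x) \<longlonglongrightarrow> indicator (region 0) x * dg i x"
    proof (intro AE_I2)
      fix x
      have "\<forall>\<^sub>F k in sequentially. indicator (region (E k)) x * dg i x = indicator (region 0) x * dg i x"
      proof (cases "x \<in> orthant - {0}")
        case True
        then have fx: "f x > 0" using f_pos by blast
        from order_tendstoD(2)[OF E(2) fx]
        show ?thesis
        proof eventually_elim
          case (elim k)
          then have "x \<in> region (E k) \<longleftrightarrow> x \<in> region 0" using fx by (auto simp: region_def)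
          then show ?case by (simp add: indicator_def)
        qed
      qed (simp add: region_def)
      then show "(\<lambda>k. indicator (region (E k)) x * dg i x) \<longlonglongrightarrow> indicator (region 0) x * dg i x"
        by (rule tendsto_eventually)
    qed
  qed (use C integrable_\<Omega> in auto)
qed

lemma partial_deriv_integral:
  shows set_integrable_partial_deriv: "set_integrable lborel \<Omega> (partial_deriv i f)"
    and LINT_partial_deriv: "(LINT x:\<Omega>|lborel. partial_deriv i f x) =
      (LINT x|lborel. indicator (region 0) x * dg i x)"
proof -
  let ?c = "partial_deriv i f 0"
  have z: "0 \<in> \<Omega>" by (simp add: \<Omega>_eq orthant_def f_0)
  \<comment> \<open>The origin is split off, since \<open>partial_deriv\<close> is identified with
    \<open>dg\<close> only away from it; its contribution is carried by a null set.\<close>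
  have eq: "indicator \<Omega> x *\<^sub>R partial_deriv i f x =
      indicator (region 0) x * dg i x + ?c * indicator {0} x" for x
    using z partial_deriv_f[of x i] nonneg[of x] by (cases "x = 0") (auto simp: indicator_def region_def \<Omega>_eq)
  have int: "integrable lborel (\<lambda>x :: real^'n. ?c * indicator {0} x)"
    by (intro integrable_mult_right integrable_real_indicator) auto
  show "set_integrable lborel \<Omega> (partial_deriv i f)"
    unfolding set_integrable_def eq using integrable_region_dg int by (rule Bochner_Integration.integrable_add)
  have "(LINT x|lborel. ?c * indicator {0} x) = 0" for x :: "real^'n" by simp
  then show "(LINT x:\<Omega>|lborel. partial_deriv i f x) =
      (LINT x|lborel. indicator (region 0) x * dg i x)"
    unfolding set_lebesgue_integral_def eq
    using Bochner_Integration.integral_add[OF integrable_region_dg int] by simp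
qed

text \<open>Brings the integrand into the form of a function of \<open>moment_map z\<close> that
  vanishes off the orthant, ready for \<open>integral_moment_map\<close>.\<close>

lemma shell_integrand:
  assumes "E > 0"
  shows "indicator (hamiltonian_shell (toric_domain \<Omega>) E) z *\<^sub>R ruelle_density (toric_domain \<Omega>) z =
    (\<Sum>i\<in>UNIV. indicator (region E) (moment_map z) * dg i (moment_map z))"
proof (cases "z = 0")
  case False
  then have "z \<in> hamiltonian_shell (toric_domain \<Omega>) E \<longleftrightarrow> moment_map z \<in> region E"
    by (simp add: hamiltonian_shell_def canonical_hamiltonian_eq H_def region_def moment_map_in_orthant)
  then show ?thesis
    using ruelle_density_toric[OF False] by (simp add: indicator_def)
qed (simp add: hamiltonian_shell_def region_def)

lemma has_ruelle_invariant_lborel: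
  "has_ruelle_invariant lborel (toric_domain \<Omega>) (\<Sum>i\<in>UNIV. LINT x:\<Omega>|lborel. partial_deriv i f x)"
  unfolding has_ruelle_invariant_def
proof
  have meas: "(\<lambda>x. indicator (region E) x * dg i x) \<in> borel_measurable borel"
    for E i by (rule borel_measurable_region_dg)
  have zero: "x \<notin> orthant \<Longrightarrow> indicator (region E) x * dg i x = 0" for E i x
    by (simp add: region_def)
  have int: "integrable lborel (\<lambda>z :: complex^'n. indicator (region E) (moment_map z) * dg i (moment_map z))" for E i
    using integrable_moment_map[OF meas zero] integrable_region_dg by blast
  have "set_integrable lborel (hamiltonian_shell (toric_domain \<Omega>) E) (ruelle_density (toric_domain \<Omega>))"
    if "E > 0" for E
    unfolding set_integrable_def shell_integrand[OF that] by (intro Bochner_Integration.integrable_sum int)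
  then show "\<forall>E>0. set_integrable lborel (hamiltonian_shell (toric_domain \<Omega>) E) (ruelle_density (toric_domain \<Omega>))"
    by blast
  have "((\<lambda>E. \<Sum>i\<in>UNIV. LINT x|lborel. indicator (region E) x * dg i x) \<longlongrightarrow>
      (\<Sum>i\<in>UNIV. LINT x:\<Omega>|lborel. partial_deriv i f x)) (at_right 0)"
    unfolding LINT_partial_deriv by (intro tendsto_sum region_integral_tendsto)
  moreover have "\<forall>\<^sub>F E in at_right 0. (\<Sum>i\<in>UNIV. LINT x|lborel. indicator (region E) x * dg i x) =
      (LINT z:hamiltonian_shell (toric_domain \<Omega>) E|lborel. ruelle_density (toric_domain \<Omega>) z)"
  proof (rule eventually_mono[OF eventually_at_right_less])
    fix E :: real assume E: "0 < E"
    have "(LINT z:hamiltonian_shell (toric_domain \<Omega>) E|lborel. ruelle_density (toric_domain \<Omega>) z) =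
        (\<Sum>i\<in>UNIV. LINT z|lborel. indicator (region E) (moment_map z) * dg i (moment_map (z :: complex^'n)))"
      unfolding set_lebesgue_integral_def shell_integrand[OF E] by (rule Bochner_Integration.integral_sum[OF int])
    then show "(\<Sum>i\<in>UNIV. LINT x|lborel. indicator (region E) x * dg i x) =
      (LINT z:hamiltonian_shell (toric_domain \<Omega>) E|lborel. ruelle_density (toric_domain \<Omega>) z)"
      using integral_moment_map[OF meas zero] by simp
  qed
  ultimately show "((\<lambda>E. LINT z:hamiltonian_shell (toric_domain \<Omega>) E|lborel. ruelle_density (toric_domain \<Omega>) z) \<longlongrightarrow>
      (\<Sum>i\<in>UNIV. LINT x:\<Omega>|lborel. partial_deriv i f x)) (at_right 0)"
    by (rule Lim_transform_eventually)
qed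

end

text \<open>The density of \<open>omega_power_measure\<close> is the constant \<open>n!\<close>,
  which factors out of every shell integral and of the limit.\<close>

lemma has_ruelle_invariant_omega_power:
  fixes X :: "(complex^'n) set"
  assumes "has_ruelle_invariant lborel X R"
  shows "has_ruelle_invariant omega_power_measure X (fact CARD('n) * R)"
proof -
  have M: "omega_power_measure = density lborel (\<lambda>_ :: complex^'n. ennreal (fact CARD('n)))"
    unfolding omega_power_measure_def by (simp add: ennreal_of_nat_eq_real_of_nat of_nat_fact)
  let ?F = "\<lambda>E z. indicator (hamiltonian_shell X E) z *\<^sub>R ruelle_density X z"
  have int: "integrable lborel (?F E)" if "E > 0" for E
    using assms that by (simp add: has_ruelle_invariant_def set_integrable_def)
  have meas: "?F E \<in> borel_measurable lborel" if "E > 0" for E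
    using int[OF that] by (rule borel_measurable_integrable)
  have lim: "((\<lambda>E. LINT z:hamiltonian_shell X E|lborel. ruelle_density X z) \<longlongrightarrow> R) (at_right 0)"
    using assms by (simp add: has_ruelle_invariant_def)
  show ?thesis
    unfolding has_ruelle_invariant_def
  proof (intro conjI allI impI)
    show "set_integrable omega_power_measure (hamiltonian_shell X E) (ruelle_density X)" if "E > 0" for E
      unfolding set_integrable_def M
      by (subst integrable_density) (use int[OF that] meas[OF that] in auto)
    have "((\<lambda>E. fact CARD('n) * (LINT z:hamiltonian_shell X E|lborel. ruelle_density X z)) \<longlongrightarrow>
        fact CARD('n) * R) (at_right 0)"
      by (intro tendsto_intros lim)
    moreover have "\<forall>\<^sub>F E in at_right 0. fact CARD('n) * (LINT z:hamiltonian_shell X E|lborel. ruelle_density X z) =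
        (LINT z:hamiltonian_shell X E|omega_power_measure. ruelle_density X z)"
    proof (rule eventually_mono[OF eventually_at_right_less])
      fix E :: real assume E: "0 < E"
      show "fact CARD('n) * (LINT z:hamiltonian_shell X E|lborel. ruelle_density X z) =
          (LINT z:hamiltonian_shell X E|omega_power_measure. ruelle_density X z)"
        unfolding set_lebesgue_integral_def M
        by (subst integral_density) (use meas[OF E] in auto)
    qed
    ultimately show "((\<lambda>E. LINT z:hamiltonian_shell X E|omega_power_measure. ruelle_density X z) \<longlongrightarrow>
        fact CARD('n) * R) (at_right 0)"
      by (rule Lim_transform_eventually)
  qed
qed

lemma ruelle_invariant_eq:
  assumes "has_ruelle_invariant M X R" shows "ruelle_invariant M X = R"
  unfolding ruelle_invariant_def
proof (rule the_equality)
  show "R' = R" if "has_ruelle_invariant M X R'" for R'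
    using that assms tendsto_unique[OF trivial_limit_at_right_real]
    unfolding has_ruelle_invariant_def by blast
qed (fact assms)

text \<open>Each value given by \<open>THE\<close> is stated together with the property defining it,
  and the integrals over \<open>\<Omega>\<close> with integrability, so that no equation rests on a
  default value.\<close>

theorem proposition5p6:
  fixes \<Omega> :: "(real^'n) set" and f :: "real^'n \<Rightarrow> real"
  assumes "\<Omega> \<subseteq> orthant"
    and "star_shaped_domain (toric_domain \<Omega>)"
    and "toric_gauge \<Omega> f"
  shows "(\<forall>z. z \<noteq> 0 \<longrightarrow>
            has_ruelle_density (toric_domain \<Omega>) z (ruelle_density (toric_domain \<Omega>) z) \<and>
            ruelle_density (toric_domain \<Omega>) z = (\<Sum>i\<in>UNIV. partial_deriv i f (moment_map z))) \<and>
         (\<forall>i. set_integrable lborel \<Omega> (partial_deriv i f)) \<and>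
         has_ruelle_invariant lborel (toric_domain \<Omega>) (ruelle_invariant lborel (toric_domain \<Omega>)) \<and>
         ruelle_invariant lborel (toric_domain \<Omega>) =
           (\<Sum>i\<in>UNIV. LINT x:\<Omega>|lborel. partial_deriv i f x) \<and>
         has_ruelle_invariant omega_power_measure (toric_domain \<Omega>)
           (ruelle_invariant omega_power_measure (toric_domain \<Omega>)) \<and>
         ruelle_invariant omega_power_measure (toric_domain \<Omega>) =
           fact CARD('n) * (\<Sum>i\<in>UNIV. LINT x:\<Omega>|lborel. partial_deriv i f x)"
proof -
  obtain U g where Ug: "open U" "orthant - {0} \<subseteq> U" "smooth_on U g" "\<forall>x \<in> orthant - {0}. g x = f x"
    using assms(3) unfolding toric_gauge_def by blast
  have f: "\<forall>x \<in> orthant. 0 \<le> f x" "{x \<in> orthant. 0 \<le> f x \<and> f x \<le> 1} = \<Omega>"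
    "\<forall>x \<in> orthant. (\<Sum>i\<in>UNIV. x $ i * partial_deriv i f x) = f x"
    using assms(3) unfolding toric_gauge_def by blast+
  interpret toric_hamiltonian \<Omega> f g U
    by unfold_locales (use assms(2) Ug f in auto)
  have density: "has_ruelle_density (toric_domain \<Omega>) z (ruelle_density (toric_domain \<Omega>) z) \<and>
      ruelle_density (toric_domain \<Omega>) z = (\<Sum>i\<in>UNIV. partial_deriv i f (moment_map z))" if "z \<noteq> 0" for z
    using that has_ruelle_density_toric[OF that] ruelle_density_toric[OF that]
    by (simp add: partial_deriv_f moment_map_in_orthant)
  note vol = has_ruelle_invariant_lborel
  note omega = has_ruelle_invariant_omega_power[OF vol]
  show ?thesis
    unfolding ruelle_invariant_eq[OF vol] ruelle_invariant_eq[OF omega]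
    using density vol omega set_integrable_partial_deriv by blast
qed

end
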